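(* Let $1\le p<\infty$. For $f\in L^p(\mathbb{R})$ let $\Psi_f(s)=\int_{-\infty}^\infty\left(\frac{1-e^{-ist}}{it}\right)f(t)\,dt$, $s\in\mathbb{R}$, and let $\Psi_f'$ denote its distributional derivative. (a) Let $\mathcal{B}_p(\mathbb{R})=\{\Psi_f\mid f\in L^p(\mathbb{R})\}$, with $\|\Psi_f\|_p'=\|f\|_p$. Then $\|\cdot\|_p'$ is a (well-defined) norm and $\mathcal{B}_p(\mathbb{R})$ is a Banach space isometrically isomorphic to $L^p(\mathbb{R})$. (b) Let $\mathcal{A}_p(\mathbb{R})=\{\Psi_f'\mid f\in L^p(\mathbb{R})\}$, with $\|\Psi_f'\|_p''=\|f\|_p$. Then $\|\cdot\|_p''$ is a (well-defined) norm and $\mathcal{A}_p(\mathbb{R})$ is a Banach space isometrically isomorphic to $L^p(\mathbb{R})$. (c) The three Banach spaces $L^p(\mathbb{R})$, $\mathcal{B}_p(\mathbb{R})$ and $\mathcal{A}_p(\mathbb{R})$ are isometrically isomorphic.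
   Context: $L^p(\mathbb{R})$ is the Lebesgue space of complex-valued functions. The kernel $t\mapsto\frac{1-e^{-ist}}{it}$ takes the value $s$ at $t=0$; it lies in $L^q(\mathbb{R})$ with $1/p+1/q=1$, so $\Psi_f$ is defined for every $s$, and $\Psi_f$ is a continuous function with $|\Psi_f(s)|\le C|s|^{1/p}$ for a constant $C$ depending on $f$ and $p$. The distributional derivative $\Psi_f'$ is the tempered distribution $\langle\Psi_f',\phi\rangle=-\int_{-\infty}^\infty\Psi_f(s)\phi'(s)\,ds$ for $\phi$ in the Schwartz space $\mathcal{S}(\mathbb{R})$. The vector space operations on $\mathcal{B}_p(\mathbb{R})$ and $\mathcal{A}_p(\mathbb{R})$ are the usual ones for functions and distributions. *)

theory Defs
  imports "HOL-Analysis.Analysis" "HOL-Algebra.Algebraic_Closure_Type"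
begin

section \<open>Complex normed spaces with explicit carriers\<close>

text \<open>
  A complex vector space is a module, in the sense of HOL-Algebra, over the field of complex
  numbers. The record fields \<open>mult\<close> and \<open>one\<close>, which modules inherit from rings, play no role.
\<close>

record 'a cnormed_space = "(complex, 'a) module" +
  nrm :: "'a \<Rightarrow> real"

definition complex_normed_space :: "('a, 'b) cnormed_space_scheme \<Rightarrow> bool" where
  "complex_normed_space V \<longleftrightarrow>
     Module.module (ring_of_type_algebra :: complex ring) V \<and>
     (\<forall>x \<in> carrier V. 0 \<le> nrm V x) \<and>
     (\<forall>x \<in> carrier V. nrm V x = 0 \<longleftrightarrow> x = \<zero>\<^bsub>V\<^esub>) \<and>
     (\<forall>c. \<forall>x \<in> carrier V. nrm V (c \<odot>\<^bsub>V\<^esub> x) = cmod c * nrm V x) \<and>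
     (\<forall>x \<in> carrier V. \<forall>y \<in> carrier V. nrm V (x \<oplus>\<^bsub>V\<^esub> y) \<le> nrm V x + nrm V y)"

text \<open>
  The locale \<open>Metric_space\<close> wants symmetry and nonnegativity on the whole type, hence the
  value 0 off the carrier.
\<close>

definition norm_dist :: "('a, 'b) cnormed_space_scheme \<Rightarrow> 'a \<Rightarrow> 'a \<Rightarrow> real" where
  "norm_dist V x y =
     (if x \<in> carrier V \<and> y \<in> carrier V then nrm V (x \<ominus>\<^bsub>V\<^esub> y) else 0)"

definition complex_banach_space :: "('a, 'b) cnormed_space_scheme \<Rightarrow> bool" where
  "complex_banach_space V \<longleftrightarrow>
     complex_normed_space V \<and> Metric_space.mcomplete (carrier V) (norm_dist V)"

definition isometrically_isomorphic ::
    "('a, 'c) cnormed_space_scheme \<Rightarrow> ('b, 'd) cnormed_space_scheme \<Rightarrow> bool" where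
  "isometrically_isomorphic V W \<longleftrightarrow>
     (\<exists>T. bij_betw T (carrier V) (carrier W) \<and>
          (\<forall>x \<in> carrier V. \<forall>y \<in> carrier V. T (x \<oplus>\<^bsub>V\<^esub> y) = T x \<oplus>\<^bsub>W\<^esub> T y) \<and>
          (\<forall>c. \<forall>x \<in> carrier V. T (c \<odot>\<^bsub>V\<^esub> x) = c \<odot>\<^bsub>W\<^esub> T x) \<and>
          (\<forall>x \<in> carrier V. nrm W (T x) = nrm V x))"


section \<open>The Lebesgue spaces on the real line\<close>

definition Lp_fun :: "real \<Rightarrow> (real \<Rightarrow> complex) set" where
  "Lp_fun p = {f \<in> borel_measurable lebesgue. integrable lebesgue (\<lambda>t. cmod (f t) powr p)}"

definition Lp_norm :: "real \<Rightarrow> (real \<Rightarrow> complex) \<Rightarrow> real" where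
  "Lp_norm p f = (\<integral>t. cmod (f t) powr p \<partial>lebesgue) powr (1 / p)"

definition Lp_eq :: "real \<Rightarrow> ((real \<Rightarrow> complex) \<times> (real \<Rightarrow> complex)) set" where
  "Lp_eq p = {(f, g). f \<in> Lp_fun p \<and> g \<in> Lp_fun p \<and> (AE t in lebesgue. f t = g t)}"

definition Lp_space :: "real \<Rightarrow> (real \<Rightarrow> complex) set cnormed_space" where
  "Lp_space p =
     \<lparr> carrier = Lp_fun p // Lp_eq p,
       mult = undefined, one = undefined,
       zero = Lp_eq p `` {\<lambda>t. 0},
       add = (\<lambda>u v. \<Union>f\<in>u. \<Union>g\<in>v. Lp_eq p `` {\<lambda>t. f t + g t}),
       smult = (\<lambda>c u. \<Union>f\<in>u. Lp_eq p `` {\<lambda>t. c * f t}),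
       nrm = (\<lambda>u. the_elem (Lp_norm p ` u)) \<rparr>"


section \<open>Tempered distributions on the real line\<close>

definition vderiv :: "(real \<Rightarrow> complex) \<Rightarrow> real \<Rightarrow> complex" where
  "vderiv \<phi> = (\<lambda>x. vector_derivative \<phi> (at x))"

definition schwartz :: "(real \<Rightarrow> complex) set" where
  "schwartz = {\<phi>. (\<forall>k x. (vderiv ^^ k) \<phi> differentiable (at x)) \<and>
                  (\<forall>m k. bounded (range (\<lambda>x. x ^ m *\<^sub>R (vderiv ^^ k) \<phi> x)))}"

definition schwartz_lim :: "(nat \<Rightarrow> real \<Rightarrow> complex) \<Rightarrow> (real \<Rightarrow> complex) \<Rightarrow> bool" where
  "schwartz_lim \<phi> \<psi> \<longleftrightarrow>
     (\<forall>m k. uniform_limit UNIV (\<lambda>n x. x ^ m *\<^sub>R (vderiv ^^ k) (\<phi> n) x)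
                               (\<lambda>x. x ^ m *\<^sub>R (vderiv ^^ k) \<psi> x) sequentially)"

text \<open>
  A functional on the Schwartz space is represented by a total function that vanishes off the
  Schwartz space, so that equal functionals are equal functions. Since the Schwartz space is
  metrizable, continuity is sequential continuity.
\<close>

definition tempered_distributions :: "((real \<Rightarrow> complex) \<Rightarrow> complex) set" where
  "tempered_distributions =
     {T. (\<forall>\<phi> \<in> schwartz. \<forall>\<psi> \<in> schwartz. \<forall>a b.
            T (\<lambda>x. a * \<phi> x + b * \<psi> x) = a * T \<phi> + b * T \<psi>) \<and>
         (\<forall>\<phi> \<psi>. (\<forall>n. \<phi> n \<in> schwartz) \<longrightarrow> \<psi> \<in> schwartz \<longrightarrow> schwartz_lim \<phi> \<psi> \<longrightarrow>
            (\<lambda>n. T (\<phi> n)) \<longlonglongrightarrow> T \<psi>) \<and>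
         (\<forall>\<phi>. \<phi> \<notin> schwartz \<longrightarrow> T \<phi> = 0)}"

definition distr_deriv :: "(real \<Rightarrow> complex) \<Rightarrow> (real \<Rightarrow> complex) \<Rightarrow> complex" where
  "distr_deriv F = (\<lambda>\<phi>. if \<phi> \<in> schwartz then - (\<integral>s. F s * vderiv \<phi> s \<partial>lebesgue) else 0)"


section \<open>The integrated Fourier transform and its distributional derivative\<close>

definition Psi_kernel :: "real \<Rightarrow> real \<Rightarrow> complex" where
  "Psi_kernel s t =
     (if t = 0 then of_real s
      else (1 - exp (- (\<i> * of_real s * of_real t))) / (\<i> * of_real t))"

definition Psi :: "(real \<Rightarrow> complex) \<Rightarrow> real \<Rightarrow> complex" where
  "Psi f s = (\<integral>t. Psi_kernel s t * f t \<partial>lebesgue)"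

text \<open>
  In both spaces the norm of \<open>x\<close> is the common \<open>p\<close>-norm of all representing functions \<open>f\<close>;
  \<open>the_elem\<close> picks the element of a set that is expected to be a singleton.
\<close>

definition B_space :: "real \<Rightarrow> (real \<Rightarrow> complex) cnormed_space" where
  "B_space p =
     \<lparr> carrier = {Psi f | f. f \<in> Lp_fun p},
       mult = undefined, one = undefined,
       zero = (\<lambda>s. 0),
       add = (\<lambda>F G s. F s + G s),
       smult = (\<lambda>c F s. c * F s),
       nrm = (\<lambda>F. the_elem {Lp_norm p f | f. f \<in> Lp_fun p \<and> Psi f = F}) \<rparr>"

definition A_space :: "real \<Rightarrow> ((real \<Rightarrow> complex) \<Rightarrow> complex) cnormed_space" where
  "A_space p =
     \<lparr> carrier = {distr_deriv (Psi f) | f. f \<in> Lp_fun p},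
       mult = undefined, one = undefined,
       zero = (\<lambda>\<phi>. 0),
       add = (\<lambda>S T \<phi>. S \<phi> + T \<phi>),
       smult = (\<lambda>c T \<phi>. c * T \<phi>),
       nrm = (\<lambda>T. the_elem {Lp_norm p f | f. f \<in> Lp_fun p \<and> distr_deriv (Psi f) = T}) \<rparr>"

end

theory Submission
  imports Defs "HOL-Probability.Probability"
begin

text \<open>Testing \<open>Psi f\<close> against the derivative of a Schwartz function \<open>\<phi>\<close> and integrating by
  parts shows that the distributional derivative of \<open>Psi f\<close> is the Fourier transform of \<open>f\<close>.
  Translated Gaussians as \<open>\<phi>\<close> yield the ordinary Fourier transform of the \<open>L\<^sup>1\<close> function
  \<open>f(t) exp(-t\<^sup>2/2)\<close> at every frequency, so \<open>f\<close> is determined almost everywhere by uniqueness of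
  characteristic functions. Hence \<open>f \<mapsto> Psi f\<close> and \<open>f \<mapsto> (Psi f)'\<close> are injective and linear on
  \<open>L\<^sup>p\<close>, and the Banach space structure is transported from \<open>L\<^sup>p\<close>, where it is Minkowski's
  inequality and the Riesz--Fischer theorem.\<close>

section \<open>The Lebesgue spaces are complete\<close>

text \<open>One estimate carries the analysis: \<open>Psi_kernel s t\<close> is bounded by (2 + |s|)
  / (1 + |t|). The factor in t makes every f in L^p absolutely integrable against the kernel, and
  the factor in s is beaten by the decay of Schwartz functions, so the double integral in s and t
  converges absolutely and Fubini applies. For large p the Fourier transform of f need not be a
  function; the transform is therefore always moved to the test function, which treats all p alike.
  Two obstacles shape the rest. Members of \<open>Lp_fun\<close> are Lebesgue measurable, whereas
  products and densities are taken over \<open>lborel\<close>, so f is first exchanged for a Borel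
  representative. And characteristic functions belong to probability measures, whereas f is complex
  valued, so its weighted version is cut into positive and negative parts of the real and imaginary
  parts.\<close>

lemma Lp_funD:
  assumes "f \<in> Lp_fun p"
  shows "f \<in> borel_measurable lebesgue" "integrable lebesgue (\<lambda>t. cmod (f t) powr p)"
  using assms by (auto simp: Lp_fun_def)

section \<open>Vector space structure of \<open>Lp_fun\<close> and Minkowski's inequality\<close>

lemma Lp_fun_zero: "(\<lambda>t. 0) \<in> Lp_fun p"
  by (simp add: Lp_fun_def)

lemma Lp_fun_cmult:
  assumes "f \<in> Lp_fun p"
  shows "(\<lambda>t. c * f t) \<in> Lp_fun p"
  using assms by (auto simp: Lp_fun_def norm_mult powr_mult)

text \<open>Bounding the sum by twice the maximum gives a crude constant, enough to keep sums in
  \<open>Lp_fun\<close>; the sharp triangle inequality builds on that membership.\<close>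

lemma powr_add_le:
  fixes a b p :: real
  assumes "0 \<le> a" "0 \<le> b" "0 \<le> p"
  shows "(a + b) powr p \<le> 2 powr p * (a powr p + b powr p)"
proof -
  have "(a + b) powr p \<le> (2 * max a b) powr p"
    using assms by (intro powr_mono2) auto
  also have "\<dots> = 2 powr p * max a b powr p"
    using assms by (simp add: powr_mult)
  also have "\<dots> \<le> 2 powr p * (a powr p + b powr p)"
    by (intro mult_left_mono) (auto simp: max_def)
  finally show ?thesis .
qed

lemma Lp_fun_add:
  assumes "0 \<le> p" "f \<in> Lp_fun p" "g \<in> Lp_fun p"
  shows "(\<lambda>t. f t + g t) \<in> Lp_fun p"
proof -
  note [measurable] = Lp_funD(1)[OF assms(2)] Lp_funD(1)[OF assms(3)]
  have "integrable lebesgue (\<lambda>t. cmod (f t + g t) powr p)"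
  proof (rule Bochner_Integration.integrable_bound)
    show "integrable lebesgue (\<lambda>t. 2 powr p * (cmod (f t) powr p + cmod (g t) powr p))"
      using Lp_funD(2)[OF assms(2)] Lp_funD(2)[OF assms(3)] by auto
    show "AE t in lebesgue. norm (cmod (f t + g t) powr p)
            \<le> norm (2 powr p * (cmod (f t) powr p + cmod (g t) powr p))"
    proof (rule AE_I2)
      fix t
      have "cmod (f t + g t) powr p \<le> (cmod (f t) + cmod (g t)) powr p"
        using assms(1) by (intro powr_mono2) (auto simp: norm_triangle_ineq)
      also have "\<dots> \<le> 2 powr p * (cmod (f t) powr p + cmod (g t) powr p)"
        using assms(1) by (intro powr_add_le) auto
      finally show "norm (cmod (f t + g t) powr p)
            \<le> norm (2 powr p * (cmod (f t) powr p + cmod (g t) powr p))"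
        by simp
    qed
  qed measurable
  then show ?thesis
    by (simp add: Lp_fun_def)
qed

lemma Lp_fun_diff:
  assumes "0 \<le> p" "f \<in> Lp_fun p" "g \<in> Lp_fun p"
  shows "(\<lambda>t. f t - g t) \<in> Lp_fun p"
  using Lp_fun_add[OF assms(1,2) Lp_fun_cmult[OF assms(3), of "-1"]] by simp

lemma Lp_norm_nonneg: "0 \<le> Lp_norm p f"
  by (simp add: Lp_norm_def)

lemma Lp_norm_powr:
  assumes "0 < p"
  shows "Lp_norm p f powr p = (\<integral>t. cmod (f t) powr p \<partial>lebesgue)"
proof -
  have "0 \<le> (\<integral>t. cmod (f t) powr p \<partial>lebesgue)"
    by (intro integral_nonneg_AE) auto
  then show ?thesis
    using assms by (simp add: Lp_norm_def powr_powr)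
qed

lemma Lp_norm_leI:
  assumes "0 < p" "0 \<le> C" "(\<integral>t. cmod (f t) powr p \<partial>lebesgue) \<le> C powr p"
  shows "Lp_norm p f \<le> C"
proof -
  have "Lp_norm p f \<le> (C powr p) powr (1 / p)"
    unfolding Lp_norm_def using assms by (intro powr_mono2 integral_nonneg_AE) auto
  then show ?thesis
    using assms by (simp add: powr_powr)
qed

lemma Lp_norm_cong_AE:
  assumes "f \<in> borel_measurable lebesgue" "g \<in> borel_measurable lebesgue"
    and "AE t in lebesgue. f t = g t"
  shows "Lp_norm p f = Lp_norm p g"
proof -
  have "(\<integral>t. cmod (f t) powr p \<partial>lebesgue) = (\<integral>t. cmod (g t) powr p \<partial>lebesgue)"
    using assms by (intro integral_cong_AE) auto
  then show ?thesis
    by (simp add: Lp_norm_def)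
qed

lemma Lp_norm_eq_0_iff:
  assumes "0 < p" "f \<in> Lp_fun p"
  shows "Lp_norm p f = 0 \<longleftrightarrow> (AE t in lebesgue. f t = 0)"
proof -
  have "Lp_norm p f = 0 \<longleftrightarrow> (\<integral>t. cmod (f t) powr p \<partial>lebesgue) = 0"
    by (simp add: Lp_norm_def)
  also have "\<dots> \<longleftrightarrow> (AE t in lebesgue. cmod (f t) powr p = 0)"
    using Lp_funD(2)[OF assms(2)] by (intro integral_nonneg_eq_0_iff_AE) auto
  finally show ?thesis
    by simp
qed

lemma Lp_norm_cmult:
  assumes "0 < p"
  shows "Lp_norm p (\<lambda>t. c * f t) = cmod c * Lp_norm p f"
proof -
  have "0 \<le> (\<integral>t. cmod (f t) powr p \<partial>lebesgue)"
    by (intro integral_nonneg_AE) auto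
  then show ?thesis
    using assms by (simp add: Lp_norm_def norm_mult powr_mult powr_powr)
qed

lemma powr_convex_combination:
  fixes p u v l :: real
  assumes "1 \<le> p" "0 \<le> u" "0 \<le> v" "0 \<le> l" "l \<le> 1"
  shows "(l * u + (1 - l) * v) powr p \<le> l * u powr p + (1 - l) * v powr p"
proof -
  \<comment> \<open>Covers an endpoint equal to zero, where the claim shrinks to l^p \<le> l;
    convexity is then invoked at two positive points.\<close>
  have scale: "(l * u) powr p \<le> l * u powr p" if "0 \<le> u" "0 \<le> l" "l \<le> 1" for l u :: real
  proof (cases "l = 0")
    case False
    then have "l powr p \<le> l powr 1"
      using assms(1) that by (intro powr_mono') auto
    then show ?thesis
      using that False by (simp add: powr_mult mult_right_mono)
  qed auto
  show ?thesis
  proof (cases "u = 0 \<or> v = 0")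
    case True
    then show ?thesis
      using scale[of u l] scale[of v "1 - l"] assms by auto
  next
    case False
    then show ?thesis
      using convex_onD[OF powr_convex[OF assms(1)], of "1 - l" u v] assms by simp
  qed
qed

text \<open>Minkowski's inequality by convexity: (|f| + |g|) / (A + B) is the convex combination of
  |f| / A and |g| / B with weights A / (A + B) and B / (A + B), so convexity of the p-th power can
  be integrated. Both normalised functions have p-th power integral 1, and the weights add up to 1.
  A vanishing norm, which would forbid the division, means that the summand is zero almost
  everywhere.\<close>

lemma Lp_norm_triangle:
  assumes p: "1 \<le> p" and f: "f \<in> Lp_fun p" and g: "g \<in> Lp_fun p"
  shows "Lp_norm p (\<lambda>t. f t + g t) \<le> Lp_norm p f + Lp_norm p g"
proof -
  note [measurable] = Lp_funD(1)[OF f] Lp_funD(1)[OF g]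
  define A B where "A = Lp_norm p f" and "B = Lp_norm p g"
  have p0: "0 < p" using p by simp
  consider "A = 0" | "B = 0" | "0 < A" "0 < B"
    using Lp_norm_nonneg[of p f] Lp_norm_nonneg[of p g] unfolding A_def B_def by linarith
  then show ?thesis
  proof cases
    case 1
    then have "AE t in lebesgue. f t = 0"
      using Lp_norm_eq_0_iff[OF p0 f] by (simp add: A_def)
    then have "Lp_norm p (\<lambda>t. f t + g t) = Lp_norm p g"
      by (intro Lp_norm_cong_AE) auto
    then show ?thesis
      using Lp_norm_nonneg[of p f] by simp
  next
    case 2
    then have "AE t in lebesgue. g t = 0"
      using Lp_norm_eq_0_iff[OF p0 g] by (simp add: B_def)
    then have "Lp_norm p (\<lambda>t. f t + g t) = Lp_norm p f"
      by (intro Lp_norm_cong_AE) auto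
    then show ?thesis
      using Lp_norm_nonneg[of p g] by simp
  next
    case 3
    define l where "l = A / (A + B)"
    have l: "0 \<le> l" "l \<le> 1" "(A + B) * l = A" "(A + B) * (1 - l) = B"
      using 3 by (auto simp: l_def field_simps)
    have pointwise: "cmod (f t + g t) powr p
        \<le> (A + B) powr p * (l * (cmod (f t) powr p / A powr p) + (1 - l) * (cmod (g t) powr p / B powr p))" for t
    proof -
      have "cmod (f t + g t) \<le> cmod (f t) + cmod (g t)"
        by (rule norm_triangle_ineq)
      also have "\<dots> = ((A + B) * l) * (cmod (f t) / A) + ((A + B) * (1 - l)) * (cmod (g t) / B)"
        using 3 by (subst l(3), subst l(4)) simp
      also have "\<dots> = (A + B) * (l * (cmod (f t) / A) + (1 - l) * (cmod (g t) / B))"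
        by (simp only: distrib_left mult.assoc)
      finally have "cmod (f t + g t) powr p
          \<le> ((A + B) * (l * (cmod (f t) / A) + (1 - l) * (cmod (g t) / B))) powr p"
        using p by (intro powr_mono2) auto
      also have "\<dots> = (A + B) powr p * (l * (cmod (f t) / A) + (1 - l) * (cmod (g t) / B)) powr p"
        by (rule powr_mult)
      also have "\<dots> \<le> (A + B) powr p * (l * (cmod (f t) / A) powr p + (1 - l) * (cmod (g t) / B) powr p)"
        using 3 l p by (intro mult_left_mono powr_convex_combination) auto
      finally show ?thesis
        using 3 by (simp add: powr_divide)
    qed
    have int: "integrable lebesgue
        (\<lambda>t. (A + B) powr p * (l * (cmod (f t) powr p / A powr p) + (1 - l) * (cmod (g t) powr p / B powr p)))"
      using Lp_funD(2)[OF f] Lp_funD(2)[OF g] by auto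
    have "(\<integral>t. cmod (f t + g t) powr p \<partial>lebesgue)
        \<le> (\<integral>t. (A + B) powr p * (l * (cmod (f t) powr p / A powr p) + (1 - l) * (cmod (g t) powr p / B powr p)) \<partial>lebesgue)"
      using Lp_fun_add[OF _ f g] p int pointwise by (intro integral_mono) (auto simp: Lp_fun_def)
    also have "\<dots> = (A + B) powr p * (l * (A powr p / A powr p) + (1 - l) * (B powr p / B powr p))"
      using Lp_funD(2)[OF f] Lp_funD(2)[OF g] unfolding A_def B_def Lp_norm_powr[OF p0] by simp
    also have "\<dots> = (A + B) powr p"
      using 3 by simp
    finally have "Lp_norm p (\<lambda>t. f t + g t) \<le> A + B"
      using 3 p0 by (intro Lp_norm_leI) auto
    then show ?thesis
      by (simp add: A_def B_def)
  qed
qed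

lemma Lp_norm_commute: "Lp_norm p (\<lambda>t. f t - g t) = Lp_norm p (\<lambda>t. g t - f t)"
  by (simp add: Lp_norm_def norm_minus_commute)

section \<open>The Riesz--Fischer theorem\<close>

lemma Lp_nn_integral:
  assumes "0 < p" "f \<in> Lp_fun p"
  shows "(\<integral>\<^sup>+t. ennreal (cmod (f t) powr p) \<partial>lebesgue) = ennreal (Lp_norm p f powr p)"
  using Lp_funD(2)[OF assms(2)] by (simp add: Lp_norm_powr[OF assms(1)] nn_integral_eq_integral)

text \<open>Fatou's lemma only bounds a nonnegative integral of the candidate limit; from that bound
  both membership and the norm estimate are drawn.\<close>

lemma Lp_funI_nn_integral:
  assumes "0 < p" "0 \<le> C" "f \<in> borel_measurable lebesgue"
    and le: "(\<integral>\<^sup>+t. ennreal (cmod (f t) powr p) \<partial>lebesgue) \<le> ennreal (C powr p)"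
  shows "f \<in> Lp_fun p" "Lp_norm p f \<le> C"
proof -
  note [measurable] = assms(3)
  have "(\<integral>\<^sup>+t. ennreal (cmod (f t) powr p) \<partial>lebesgue) < \<infinity>"
    using le by (rule order.strict_trans1) simp
  then show f: "f \<in> Lp_fun p"
    by (simp add: Lp_fun_def integrable_iff_bounded)
  have "Lp_norm p f powr p \<le> C powr p"
    using le Lp_nn_integral[OF assms(1) f] by (simp add: ennreal_le_iff)
  then show "Lp_norm p f \<le> C"
    using assms(1,2) by (intro Lp_norm_leI) (simp_all add: Lp_norm_powr)
qed

lemma convergent_geometric_increments:
  fixes u :: "nat \<Rightarrow> 'a::banach"
  assumes "eventually (\<lambda>k. norm (u (Suc k) - u k) \<le> (1 / 2) ^ k) sequentially"
  shows "convergent u"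
proof -
  have "summable (\<lambda>k. u (Suc k) - u k)"
    using assms by (rule summable_comparison_test_ev) (simp add: summable_geometric)
  then have "(\<lambda>n. (\<Sum>k<n. u (Suc k) - u k) + u 0) \<longlonglongrightarrow> (\<Sum>k. u (Suc k) - u k) + u 0"
    by (intro tendsto_intros summable_LIMSEQ)
  then show ?thesis
    unfolding sum_lessThan_telescope by (auto simp: convergent_def)
qed

text \<open>Riesz--Fischer: along a subsequence with increments of norm at most \<open>4\<^sup>-\<^sup>k\<close> the sum
  of \<open>(2\<^sup>k |increment|)\<^sup>p\<close> is integrable, which forces convergence almost everywhere;
  Fatou's lemma then gives convergence in norm.\<close>

lemma Lp_complete:
  assumes p: "1 \<le> p" and f: "\<And>n. f n \<in> Lp_fun p"
    and cauchy: "\<And>e. 0 < e \<Longrightarrow> \<exists>N. \<forall>m\<ge>N. \<forall>n\<ge>N. Lp_norm p (\<lambda>t. f m t - f n t) < e"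
  obtains g where "g \<in> Lp_fun p" "(\<lambda>n. Lp_norm p (\<lambda>t. f n t - g t)) \<longlonglongrightarrow> 0"
proof -
  have p0: "0 < p" using p by simp
  note [measurable] = Lp_funD(1)[OF f]
  have fd: "(\<lambda>t. f m t - f n t) \<in> Lp_fun p" for m n
    using p f by (intro Lp_fun_diff) auto
  have "\<exists>N. \<forall>m\<ge>N. \<forall>n\<ge>N. Lp_norm p (\<lambda>t. f m t - f n t) < (1 / 4) ^ k" for k
    by (rule cauchy) simp
  then obtain N where N: "\<And>k m n. N k \<le> m \<Longrightarrow> N k \<le> n \<Longrightarrow> Lp_norm p (\<lambda>t. f m t - f n t) < (1 / 4) ^ k"
    by metis
  \<comment> \<open>Summing makes \<open>r k\<close> dominate every \<open>N j\<close> with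
    \<open>j \<le> k\<close>, so \<open>r k\<close> and \<open>r (Suc k)\<close> both lie beyond
    \<open>N k\<close>.\<close>
  define r where "r k = (\<Sum>i\<le>k. N i)" for k
  have r_ge: "N j \<le> r k" if "j \<le> k" for j k
    unfolding r_def using that by (intro member_le_sum) auto
  define d where "d k t = f (r (Suc k)) t - f (r k) t" for k t
  have d: "d k \<in> Lp_fun p" for k
    unfolding d_def by (rule fd)
  have d_norm: "Lp_norm p (d k) \<le> (1 / 4) ^ k" for k
    unfolding d_def using N[OF r_ge r_ge, of k "Suc k" k] by simp
  note [measurable] = Lp_funD(1)[OF d]
  define S where "S t = (\<Sum>k. ennreal ((2 ^ k * cmod (d k t)) powr p))" for t
  have S_meas: "S \<in> borel_measurable lebesgue"
    unfolding S_def by measurable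
  \<comment> \<open>The weight 2^k uses up part of the decay 4^(-k): what remains is (1/2)^k, whose
    p-th powers form a convergent geometric series, while finiteness of the weighted sum still
    forces increments of size at most 2^(-k) eventually.\<close>
  have term_le: "(\<integral>\<^sup>+t. ennreal ((2 ^ k * cmod (d k t)) powr p) \<partial>lebesgue) \<le> ennreal (((1 / 2) powr p) ^ k)" for k
  proof -
    have "(\<integral>\<^sup>+t. ennreal ((2 ^ k * cmod (d k t)) powr p) \<partial>lebesgue)
        = (\<integral>\<^sup>+t. ennreal ((2 ^ k) powr p) * ennreal (cmod (d k t) powr p) \<partial>lebesgue)"
      by (simp add: powr_mult ennreal_mult)
    also have "\<dots> = ennreal ((2 ^ k) powr p) * ennreal (Lp_norm p (d k) powr p)"
      by (simp add: nn_integral_cmult Lp_nn_integral[OF p0 d])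
    also have "\<dots> = ennreal ((2 ^ k * Lp_norm p (d k)) powr p)"
      using Lp_norm_nonneg by (simp add: powr_mult ennreal_mult)
    also have "\<dots> \<le> ennreal (((1 / 2) ^ k) powr p)"
    proof (intro ennreal_leI powr_mono2)
      have "2 ^ k * Lp_norm p (d k) \<le> 2 ^ k * (1 / 4) ^ k"
        by (intro mult_left_mono d_norm) simp
      then show "2 ^ k * Lp_norm p (d k) \<le> (1 / 2) ^ k"
        by (simp flip: power_mult_distrib)
    qed (use p Lp_norm_nonneg in auto)
    also have "((1 / 2 :: real) ^ k) powr p = ((1 / 2) powr p) ^ k"
      by (simp add: powr_powr mult.commute flip: powr_realpow)
    finally show ?thesis .
  qed
  have half: "(1 / 2 :: real) powr p < 1"
    using powr_less_mono2[of p "1 / 2" 1] p0 by simp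
  have "(\<integral>\<^sup>+t. S t \<partial>lebesgue) = (\<Sum>k. \<integral>\<^sup>+t. ennreal ((2 ^ k * cmod (d k t)) powr p) \<partial>lebesgue)"
    unfolding S_def by (intro nn_integral_suminf) measurable
  also have "\<dots> \<le> (\<Sum>k. ennreal (((1 / 2) powr p) ^ k))"
    by (intro suminf_le term_le) auto
  also have "\<dots> = ennreal (\<Sum>k. ((1 / 2) powr p) ^ k)"
    using half by (intro suminf_ennreal2 summable_geometric) auto
  finally have "(\<integral>\<^sup>+t. S t \<partial>lebesgue) \<noteq> \<infinity>"
    by (metis ennreal_less_top infinity_ennreal_def leD)
  then have "AE t in lebesgue. S t \<noteq> \<infinity>"
    by (intro nn_integral_PInf_AE S_meas)
  then have conv: "AE t in lebesgue. convergent (\<lambda>k. f (r k) t)"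
  proof (rule AE_mp, intro AE_I2 impI)
    fix t assume "S t \<noteq> \<infinity>"
    then have "summable (\<lambda>k. (2 ^ k * cmod (d k t)) powr p)"
      unfolding S_def by (intro summable_suminf_not_top) auto
    then have "eventually (\<lambda>k. (2 ^ k * cmod (d k t)) powr p < 1) sequentially"
      by (rule order_tendstoD(2)[OF summable_LIMSEQ_zero]) simp
    then have "eventually (\<lambda>k. norm (f (r (Suc k)) t - f (r k) t) \<le> (1 / 2) ^ k) sequentially"
    proof eventually_elim
      fix k assume "(2 ^ k * cmod (d k t)) powr p < 1"
      then have "2 ^ k * cmod (d k t) \<le> 1"
        using p0 by (smt (verit) ge_one_powr_ge_zero)
      then show "norm (f (r (Suc k)) t - f (r k) t) \<le> (1 / 2) ^ k"
        by (simp add: d_def field_simps)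
    qed
    then show "convergent (\<lambda>k. f (r k) t)"
      by (rule convergent_geometric_increments)
  qed
  \<comment> \<open>\<open>lim\<close> has an unspecified value where the sequence diverges; this
    happens only on a null set, and \<open>g\<close> is measurable regardless.\<close>
  define g where "g t = lim (\<lambda>k. f (r k) t)" for t
  have [measurable]: "g \<in> borel_measurable lebesgue"
    unfolding g_def by measurable
  have fatou: "(\<lambda>t. f n t - g t) \<in> Lp_fun p \<and> Lp_norm p (\<lambda>t. f n t - g t) \<le> (1 / 4) ^ j"
    if n: "N j \<le> n" for n j
  proof -
    \<comment> \<open>Only the second index runs along the subsequence, so the Cauchy bound for the
      fixed \<open>n\<close> passes to the limit and convergence holds for the full
      sequence.\<close>
    have "AE t in lebesgue. ennreal (cmod (f n t - g t) powr p)
        = liminf (\<lambda>k. ennreal (cmod (f n t - f (r k) t) powr p))"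
      using conv
    proof eventually_elim
      fix t assume "convergent (\<lambda>k. f (r k) t)"
      then have "(\<lambda>k. f (r k) t) \<longlonglongrightarrow> g t"
        by (simp add: g_def convergent_LIMSEQ_iff)
      then have "(\<lambda>k. ennreal (cmod (f n t - f (r k) t) powr p)) \<longlonglongrightarrow> ennreal (cmod (f n t - g t) powr p)"
        using p0 by (intro tendsto_ennrealI tendsto_powr' tendsto_intros) auto
      then show "ennreal (cmod (f n t - g t) powr p)
          = liminf (\<lambda>k. ennreal (cmod (f n t - f (r k) t) powr p))"
        by (intro lim_imp_Liminf[symmetric]) auto
    qed
    then have "(\<integral>\<^sup>+t. ennreal (cmod (f n t - g t) powr p) \<partial>lebesgue)
        = (\<integral>\<^sup>+t. liminf (\<lambda>k. ennreal (cmod (f n t - f (r k) t) powr p)) \<partial>lebesgue)"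
      by (intro nn_integral_cong_AE)
    also have "\<dots> \<le> liminf (\<lambda>k. \<integral>\<^sup>+t. ennreal (cmod (f n t - f (r k) t) powr p) \<partial>lebesgue)"
      by (intro nn_integral_liminf) measurable
    also have "\<dots> \<le> liminf (\<lambda>k. ennreal (((1 / 4) ^ j) powr p))"
    proof (intro Liminf_mono eventually_sequentiallyI)
      fix k assume "j \<le> k"
      then have "Lp_norm p (\<lambda>t. f n t - f (r k) t) \<le> (1 / 4) ^ j"
        using N[OF n r_ge] by (simp add: less_imp_le)
      then show "(\<integral>\<^sup>+t. ennreal (cmod (f n t - f (r k) t) powr p) \<partial>lebesgue) \<le> ennreal (((1 / 4) ^ j) powr p)"
        unfolding Lp_nn_integral[OF p0 fd] using p0 Lp_norm_nonneg
        by (intro ennreal_leI powr_mono2) auto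
    qed
    also have "\<dots> = ennreal (((1 / 4) ^ j) powr p)"
      by (simp add: Liminf_const)
    finally have le: "(\<integral>\<^sup>+t. ennreal (cmod (f n t - g t) powr p) \<partial>lebesgue) \<le> ennreal (((1 / 4) ^ j) powr p)" .
    show ?thesis
      using Lp_funI_nn_integral[OF p0 _ _ le] by simp
  qed
  have "(\<lambda>t. f (N 0) t - (f (N 0) t - g t)) \<in> Lp_fun p"
    by (rule Lp_fun_diff) (use fatou[of 0 "N 0"] p f in auto)
  then have g: "g \<in> Lp_fun p"
    by simp
  have "(\<lambda>n. Lp_norm p (\<lambda>t. f n t - g t)) \<longlonglongrightarrow> 0"
  proof (rule LIMSEQ_I)
    fix e :: real assume "0 < e"
    then obtain j where j: "(1 / 4) ^ j < e"
      using real_arch_pow_inv[of e "1 / 4"] by auto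
    have "\<forall>n\<ge>N j. norm (Lp_norm p (\<lambda>t. f n t - g t) - 0) < e"
      using fatou j Lp_norm_nonneg by (auto intro: le_less_trans)
    then show "\<exists>no. \<forall>n\<ge>no. norm (Lp_norm p (\<lambda>t. f n t - g t) - 0) < e" ..
  qed
  with g show ?thesis
    by (rule that)
qed

section \<open>Isometric copies of the Lebesgue space\<close>

text \<open>Each of the three spaces is the image of \<open>Lp_fun p\<close> under a linear map
  \<open>Phi\<close> whose kernel consists of the functions vanishing almost everywhere, normed by the
  \<open>p\<close>-norm of a preimage. Completeness and the isometries only depend on this.\<close>

locale Lp_realization =
  fixes p :: real and W :: "('a, 'b) cnormed_space_scheme" and Phi :: "(real \<Rightarrow> complex) \<Rightarrow> 'a"
  assumes p: "1 \<le> p"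
    and carrier: "carrier W = Phi ` Lp_fun p"
    and Phi_eq_iff: "f \<in> Lp_fun p \<Longrightarrow> g \<in> Lp_fun p \<Longrightarrow>
      Phi f = Phi g \<longleftrightarrow> (AE t in lebesgue. f t = g t)"
    and Phi_zero: "\<zero>\<^bsub>W\<^esub> = Phi (\<lambda>t. 0)"
    and Phi_add: "f \<in> Lp_fun p \<Longrightarrow> g \<in> Lp_fun p \<Longrightarrow> Phi f \<oplus>\<^bsub>W\<^esub> Phi g = Phi (\<lambda>t. f t + g t)"
    and Phi_smult: "f \<in> Lp_fun p \<Longrightarrow> c \<odot>\<^bsub>W\<^esub> Phi f = Phi (\<lambda>t. c * f t)"
    and nrm_Phi: "f \<in> Lp_fun p \<Longrightarrow> nrm W (Phi f) = Lp_norm p f"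
begin

lemma add_closed: "f \<in> Lp_fun p \<Longrightarrow> g \<in> Lp_fun p \<Longrightarrow> (\<lambda>t. f t + g t) \<in> Lp_fun p"
  using p by (intro Lp_fun_add) auto

lemma diff_closed: "f \<in> Lp_fun p \<Longrightarrow> g \<in> Lp_fun p \<Longrightarrow> (\<lambda>t. f t - g t) \<in> Lp_fun p"
  using p by (intro Lp_fun_diff) auto

lemma abelian_group: "abelian_group W"
proof (rule abelian_groupI)
  fix x assume "x \<in> carrier W"
  then obtain f where f: "f \<in> Lp_fun p" "x = Phi f"
    by (auto simp: carrier)
  have "(\<lambda>t. - f t) \<in> Lp_fun p"
    using Lp_fun_cmult[OF f(1), of "-1"] by simp
  then show "\<exists>y\<in>carrier W. y \<oplus>\<^bsub>W\<^esub> x = \<zero>\<^bsub>W\<^esub>"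
    using f by (intro bexI[of _ "Phi (\<lambda>t. - f t)"]) (auto simp: carrier Phi_add Phi_zero)
next
  fix x y z assume "x \<in> carrier W" "y \<in> carrier W" "z \<in> carrier W"
  then obtain f g h where fgh: "f \<in> Lp_fun p" "g \<in> Lp_fun p" "h \<in> Lp_fun p"
      "x = Phi f" "y = Phi g" "z = Phi h"
    by (auto simp: carrier)
  show "x \<oplus>\<^bsub>W\<^esub> y \<oplus>\<^bsub>W\<^esub> z = x \<oplus>\<^bsub>W\<^esub> (y \<oplus>\<^bsub>W\<^esub> z)"
    using fgh by (simp add: Phi_add add_closed add.assoc)
  show "x \<oplus>\<^bsub>W\<^esub> y = y \<oplus>\<^bsub>W\<^esub> x"
    using fgh by (simp add: Phi_add add.commute)
qed (auto simp: carrier Phi_add Phi_zero add_closed Lp_fun_zero)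

lemma module: "Module.module (ring_of_type_algebra :: complex ring) W"
proof (rule moduleI)
  show "cring (ring_of_type_algebra :: complex ring)"
    by (rule cring_from_type_algebra)
qed (auto simp: abelian_group ring_of_type_algebra_def carrier Phi_smult Phi_add add_closed
      Lp_fun_cmult algebra_simps)

lemma Phi_diff:
  assumes f: "f \<in> Lp_fun p" and g: "g \<in> Lp_fun p"
  shows "Phi f \<ominus>\<^bsub>W\<^esub> Phi g = Phi (\<lambda>t. f t - g t)"
proof -
  interpret abelian_group W by (rule abelian_group)
  have mg: "(\<lambda>t. - g t) \<in> Lp_fun p"
    using Lp_fun_cmult[OF g, of "-1"] by simp
  have "\<ominus>\<^bsub>W\<^esub> Phi g = Phi (\<lambda>t. - g t)"
    by (rule minus_equality) (use g mg in \<open>auto simp: carrier Phi_add Phi_zero\<close>)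
  then show ?thesis
    using f mg by (simp add: a_minus_def Phi_add)
qed

lemma complex_normed_space: "complex_normed_space W"
  unfolding complex_normed_space_def
proof (intro conjI ballI allI)
  fix x assume "x \<in> carrier W"
  then obtain f where f: "f \<in> Lp_fun p" "x = Phi f"
    by (auto simp: carrier)
  show "0 \<le> nrm W x"
    using f by (simp add: nrm_Phi Lp_norm_nonneg)
  show "nrm W x = 0 \<longleftrightarrow> x = \<zero>\<^bsub>W\<^esub>"
    using f p by (simp add: nrm_Phi Phi_zero Phi_eq_iff Lp_fun_zero Lp_norm_eq_0_iff)
  show "nrm W (c \<odot>\<^bsub>W\<^esub> x) = cmod c * nrm W x" for c
    using f p by (simp add: Phi_smult nrm_Phi Lp_fun_cmult Lp_norm_cmult)
  fix y assume "y \<in> carrier W"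
  then obtain g where g: "g \<in> Lp_fun p" "y = Phi g"
    by (auto simp: carrier)
  show "nrm W (x \<oplus>\<^bsub>W\<^esub> y) \<le> nrm W x + nrm W y"
    using f g p by (simp add: Phi_add nrm_Phi add_closed Lp_norm_triangle)
qed (rule module)

lemma norm_dist_Phi:
  assumes "f \<in> Lp_fun p" "g \<in> Lp_fun p"
  shows "norm_dist W (Phi f) (Phi g) = Lp_norm p (\<lambda>t. f t - g t)"
  using assms by (simp add: norm_dist_def carrier Phi_diff nrm_Phi diff_closed)

lemma Metric_space: "Metric_space (carrier W) (norm_dist W)"
proof
  show "0 \<le> norm_dist W x y" for x y
  proof (cases "x \<in> carrier W \<and> y \<in> carrier W")
    case True
    then show ?thesis
      by (auto simp: carrier norm_dist_Phi Lp_norm_nonneg)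
  qed (auto simp: norm_dist_def)
  show "norm_dist W x y = norm_dist W y x" for x y
  proof (cases "x \<in> carrier W \<and> y \<in> carrier W")
    case True
    then show ?thesis
      by (auto simp: carrier norm_dist_Phi intro: Lp_norm_commute)
  qed (auto simp: norm_dist_def)
  fix x y assume "x \<in> carrier W" "y \<in> carrier W"
  then obtain f g where fg: "f \<in> Lp_fun p" "x = Phi f" "g \<in> Lp_fun p" "y = Phi g"
    by (auto simp: carrier)
  show "norm_dist W x y = 0 \<longleftrightarrow> x = y"
    using fg p by (simp add: norm_dist_Phi Phi_eq_iff diff_closed Lp_norm_eq_0_iff)
  fix z assume "z \<in> carrier W"
  then obtain h where h: "h \<in> Lp_fun p" "z = Phi h"
    by (auto simp: carrier)
  show "norm_dist W x z \<le> norm_dist W x y + norm_dist W y z"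
    using Lp_norm_triangle[OF p diff_closed[OF fg(1,3)] diff_closed[OF fg(3) h(1)]] fg h
    by (simp add: norm_dist_Phi)
qed

lemma complex_banach_space: "complex_banach_space W"
proof -
  interpret Metric_space "carrier W" "norm_dist W"
    by (rule Metric_space)
  have mcomplete
    unfolding mcomplete_def
  proof (intro allI impI)
    fix s assume s: "MCauchy s"
    then have "range s \<subseteq> Phi ` Lp_fun p"
      by (simp add: MCauchy_def flip: carrier)
    then have "\<forall>n. \<exists>f\<in>Lp_fun p. s n = Phi f"
      by blast
    then obtain f where f: "\<And>n. f n \<in> Lp_fun p" "\<And>n. s n = Phi (f n)"
      by metis
    have "\<exists>N. \<forall>m\<ge>N. \<forall>n\<ge>N. Lp_norm p (\<lambda>t. f m t - f n t) < e" if "0 < e" for e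
    proof -
      have "norm_dist W (s m) (s n) = Lp_norm p (\<lambda>t. f m t - f n t)" for m n
        by (simp add: f norm_dist_Phi)
      then show ?thesis
        using s that unfolding MCauchy_def by metis
    qed
    from Lp_complete[OF p f(1) this]
    obtain g where g: "g \<in> Lp_fun p" "(\<lambda>n. Lp_norm p (\<lambda>t. f n t - g t)) \<longlonglongrightarrow> 0"
      by metis
    have "\<exists>N. \<forall>n\<ge>N. Lp_norm p (\<lambda>t. f n t - g t) < e" if "0 < e" for e
      using order_tendstoD(2)[OF g(2) that] by (simp add: eventually_sequentially)
    then have "limitin mtopology s (Phi g) sequentially"
      using f g(1) unfolding limit_metric_sequentially by (simp add: norm_dist_Phi) (simp add: carrier)
    then show "\<exists>x. limitin mtopology s x sequentially" ..
  qed
  then show ?thesis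
    by (simp add: complex_banach_space_def complex_normed_space)
qed

end

text \<open>Sending \<open>Phi f\<close> to \<open>Phi' f\<close> is independent of the choice of
  \<open>f\<close>, and injective, because both realizations identify exactly the functions that
  agree almost everywhere; \<open>inv_into\<close> merely picks some preimage.\<close>

lemma Lp_realizations_isometric:
  assumes "Lp_realization p V Phi" "Lp_realization p W Phi'"
  shows "isometrically_isomorphic V W"
proof -
  interpret V: Lp_realization p V Phi by fact
  interpret W: Lp_realization p W Phi' by fact
  define T where "T x = Phi' (inv_into (Lp_fun p) Phi x)" for x
  have T: "T (Phi f) = Phi' f" if f: "f \<in> Lp_fun p" for f
  proof -
    have "inv_into (Lp_fun p) Phi (Phi f) \<in> Lp_fun p"
      using f by (intro inv_into_into imageI)
    moreover have "Phi (inv_into (Lp_fun p) Phi (Phi f)) = Phi f"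
      using f_inv_into_f[of "Phi f" Phi "Lp_fun p"] f by simp
    ultimately show ?thesis
      using f unfolding T_def by (simp add: V.Phi_eq_iff W.Phi_eq_iff)
  qed
  show ?thesis
    unfolding isometrically_isomorphic_def
  proof (intro exI[of _ T] conjI ballI allI)
    show "bij_betw T (carrier V) (carrier W)"
      by (auto simp: bij_betw_def inj_on_def V.carrier W.carrier T V.Phi_eq_iff W.Phi_eq_iff image_image)
  qed (auto simp: V.carrier T V.Phi_add W.Phi_add V.Phi_smult W.Phi_smult V.nrm_Phi W.nrm_Phi
        V.add_closed Lp_fun_cmult)
qed

section \<open>Realizing the quotient space and spaces with pointwise operations\<close>

lemma equiv_Lp_eq: "equiv (Lp_fun p) (Lp_eq p)"
proof (intro equivI refl_onI symI transI)
  show "(f, h) \<in> Lp_eq p" if "(f, g) \<in> Lp_eq p" "(g, h) \<in> Lp_eq p" for f g h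
    using that by (auto simp: Lp_eq_def)
qed (auto simp: Lp_eq_def)

text \<open>The operations on classes are unions over all representatives. Each union runs over
  equal classes and so collapses to the one computed from the chosen representatives. Likewise the
  norm is constant on a class, which gives \<open>the_elem\<close> a singleton.\<close>

lemma Lp_realization_Lp_space:
  assumes p: "1 \<le> p"
  shows "Lp_realization p (Lp_space p) (\<lambda>f. Lp_eq p `` {f})"
proof
  show "carrier (Lp_space p) = (\<lambda>f. Lp_eq p `` {f}) ` Lp_fun p"
    by (auto simp: Lp_space_def quotient_def)
  show "Lp_eq p `` {f} = Lp_eq p `` {g} \<longleftrightarrow> (AE t in lebesgue. f t = g t)"
    if "f \<in> Lp_fun p" "g \<in> Lp_fun p" for f g
    using that by (simp add: eq_equiv_class_iff[OF equiv_Lp_eq]) (simp add: Lp_eq_def)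
  show "Lp_eq p `` {f} \<oplus>\<^bsub>Lp_space p\<^esub> Lp_eq p `` {g} = Lp_eq p `` {\<lambda>t. f t + g t}"
    if "f \<in> Lp_fun p" "g \<in> Lp_fun p" for f g
  proof -
    have "congruent2 (Lp_eq p) (Lp_eq p) (\<lambda>f g. Lp_eq p `` {\<lambda>t. f t + g t})"
    proof (rule congruent2I')
      fix f f' g g' assume "(f, f') \<in> Lp_eq p" "(g, g') \<in> Lp_eq p"
      then have "((\<lambda>t. f t + g t), (\<lambda>t. f' t + g' t)) \<in> Lp_eq p"
        using p by (auto simp: Lp_eq_def intro!: Lp_fun_add)
      then show "Lp_eq p `` {\<lambda>t. f t + g t} = Lp_eq p `` {\<lambda>t. f' t + g' t}"
        by (rule equiv_class_eq[OF equiv_Lp_eq])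
    qed
    from UN_equiv_class2[OF equiv_Lp_eq equiv_Lp_eq this that]
    show ?thesis
      by (simp add: Lp_space_def)
  qed
  show "c \<odot>\<^bsub>Lp_space p\<^esub> Lp_eq p `` {f} = Lp_eq p `` {\<lambda>t. c * f t}" if "f \<in> Lp_fun p" for f c
  proof -
    have "congruent (Lp_eq p) (\<lambda>f. Lp_eq p `` {\<lambda>t. c * f t})"
    proof (rule congruentI)
      fix f f' assume "(f, f') \<in> Lp_eq p"
      then have "((\<lambda>t. c * f t), (\<lambda>t. c * f' t)) \<in> Lp_eq p"
        by (auto simp: Lp_eq_def intro!: Lp_fun_cmult)
      then show "Lp_eq p `` {\<lambda>t. c * f t} = Lp_eq p `` {\<lambda>t. c * f' t}"
        by (rule equiv_class_eq[OF equiv_Lp_eq])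
    qed
    from UN_equiv_class[OF equiv_Lp_eq this that]
    show ?thesis
      by (simp add: Lp_space_def)
  qed
  show "nrm (Lp_space p) (Lp_eq p `` {f}) = Lp_norm p f" if "f \<in> Lp_fun p" for f
  proof -
    have "Lp_norm p ` (Lp_eq p `` {f}) = {Lp_norm p f}"
      using that equiv_class_self[OF equiv_Lp_eq that]
      by (auto simp: Lp_eq_def Lp_funD(1) intro!: Lp_norm_cong_AE)
    then show ?thesis
      by (simp add: Lp_space_def)
  qed
qed (use p in \<open>auto simp: Lp_space_def\<close>)

text \<open>Serves both remaining spaces: elements of one are functions of s, those of the other are
  functions of the test function, and in both the operations are pointwise. The set under
  \<open>the_elem\<close> is a singleton because functions with the same image agree almost
  everywhere and hence have the same norm.\<close>

lemma Lp_realization_function_space: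
  fixes Phi :: "(real \<Rightarrow> complex) \<Rightarrow> 'x \<Rightarrow> complex"
  assumes p: "1 \<le> p"
    and W: "carrier W = {Phi f | f. f \<in> Lp_fun p}" "zero W = (\<lambda>x. 0)"
      "add W = (\<lambda>F G x. F x + G x)" "smult W = (\<lambda>c F x. c * F x)"
      "nrm W = (\<lambda>F. the_elem {Lp_norm p f | f. f \<in> Lp_fun p \<and> Phi f = F})"
    and eq: "\<And>f g. f \<in> Lp_fun p \<Longrightarrow> g \<in> Lp_fun p \<Longrightarrow> Phi f = Phi g \<longleftrightarrow> (AE t in lebesgue. f t = g t)"
    and add: "\<And>f g x. f \<in> Lp_fun p \<Longrightarrow> g \<in> Lp_fun p \<Longrightarrow> Phi (\<lambda>t. f t + g t) x = Phi f x + Phi g x"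
    and cmult: "\<And>f c x. f \<in> Lp_fun p \<Longrightarrow> Phi (\<lambda>t. c * f t) x = c * Phi f x"
  shows "Lp_realization p W Phi"
proof
  show "\<zero>\<^bsub>W\<^esub> = Phi (\<lambda>t. 0)"
    using cmult[OF Lp_fun_zero, of 0] by (auto simp: W)
  show "nrm W (Phi f) = Lp_norm p f" if f: "f \<in> Lp_fun p" for f
  proof -
    have "{Lp_norm p g | g. g \<in> Lp_fun p \<and> Phi g = Phi f} = {Lp_norm p f}"
      using f by (auto simp: eq Lp_funD(1) intro!: Lp_norm_cong_AE)
    then show ?thesis
      by (simp add: W)
  qed
qed (auto simp: p W eq add cmult)

section \<open>The integrated Fourier transform\<close>

text \<open>The half-line integral has an explicit antiderivative, and reflection covers the other
  half. With \<open>q\<close> dual to \<open>p\<close> this places 1 / (1 + |t|) in L^q; with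
  \<open>q = 2\<close> it provides the majorant for Schwartz functions.\<close>

lemma integrable_lborel_one_plus_abs_powr:
  fixes q :: real
  assumes q: "1 < q"
  shows "integrable lborel (\<lambda>t. (1 + \<bar>t\<bar>) powr (- q))"
proof -
  define h where "h t = (1 + t) powr (- q) * indicator {0..} t" for t :: real
  have "(\<integral>\<^sup>+t. ennreal ((1 + t) powr (- q)) * indicator {0..} t \<partial>lborel)
      = ennreal (0 - (- ((1 + 0) powr (1 - q)) / (q - 1)))"
  proof (rule nn_integral_FTC_atLeast)
    show "((\<lambda>t. - ((1 + t) powr (1 - q)) / (q - 1)) has_real_derivative (1 + t) powr (- q)) (at t)"
      if "0 \<le> t" for t
    proof -
      have "((\<lambda>t. - ((1 + t) powr (1 - q)) / (q - 1)) has_real_derivative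
          - ((1 - q) * (1 + t) powr (1 - q - 1)) / (q - 1)) (at t)"
        using that q by (auto intro!: derivative_eq_intros)
      moreover have "- ((1 - q) * (1 + t) powr (1 - q - 1)) / (q - 1) = (1 + t) powr (- q)"
        using q by (simp add: divide_eq_eq algebra_simps)
      ultimately show ?thesis
        by simp
    qed
    have "((\<lambda>t. - ((1 + t) powr (1 - q)) / (q - 1)) \<longlongrightarrow> - 0 / (q - 1)) at_top"
      using q by (intro tendsto_intros tendsto_neg_powr filterlim_tendsto_add_at_top[OF tendsto_const]
          filterlim_ident) auto
    then show "((\<lambda>t. - ((1 + t) powr (1 - q)) / (q - 1)) \<longlongrightarrow> 0) at_top"
      by simp
  qed auto
  then have "integrable lborel h"
    unfolding h_def
    by (intro integrableI_nonneg) (auto simp: ennreal_mult' ennreal_indicator)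
  moreover from this have "integrable lborel (\<lambda>t. h (- t))"
    using lborel_integrable_real_affine[of h "-1" 0] by simp
  \<comment> \<open>The sum equals the claimed function except at 0, where it is twice as large; it
    therefore serves as a majorant.\<close>
  ultimately have "integrable lborel (\<lambda>t. h t + h (- t))"
    by auto
  then show ?thesis
    by (rule Bochner_Integration.integrable_bound) (auto simp: h_def indicator_def)
qed

lemma one_plus_abs_lebesgue_measurable [measurable]:
  "(\<lambda>t. 1 + \<bar>t\<bar> :: real) \<in> borel_measurable lebesgue"
  by (rule measurable_completion) simp

text \<open>Only integrability is wanted from Hoelder's inequality, so Young's inequality is applied
  pointwise, with majorant |f|^p / p + (1 + |t|)^(-q) / q. For \<open>p = 1\<close> the dual
  exponent is infinite and the weight is simply bounded by 1.\<close>

lemma Lp_integrable_decay: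
  assumes p: "1 \<le> p" and f: "f \<in> Lp_fun p"
  shows "integrable lebesgue (\<lambda>t. cmod (f t) / (1 + \<bar>t\<bar>))"
proof (cases "p = 1")
  case True
  note [measurable] = Lp_funD(1)[OF f]
  show ?thesis
    using Lp_funD(2)[OF f]
    by (rule Bochner_Integration.integrable_bound)
       (auto simp: True divide_le_eq mult_le_cancel_left1)
next
  case False
  note [measurable] = Lp_funD(1)[OF f]
  define q where "q = p / (p - 1)"
  have q: "1 < q" "1 / p + 1 / q = 1"
    using p False by (auto simp: q_def field_simps)
  have "integrable lebesgue (\<lambda>t. (1 + \<bar>t\<bar>) powr (- q))"
    using integrable_lborel_one_plus_abs_powr[OF q(1)] by (subst integrable_completion) auto
  then have "integrable lebesgue (\<lambda>t. cmod (f t) powr p / p + (1 + \<bar>t\<bar>) powr (- q) / q)"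
    using Lp_funD(2)[OF f] by auto
  then show ?thesis
  proof (rule Bochner_Integration.integrable_bound)
    show "AE t in lebesgue. norm (cmod (f t) / (1 + \<bar>t\<bar>))
        \<le> norm (cmod (f t) powr p / p + (1 + \<bar>t\<bar>) powr (- q) / q)"
    proof (rule AE_I2)
      fix t
      have "cmod (f t) * (1 + \<bar>t\<bar>) powr (- 1) \<le> cmod (f t) powr p / p + ((1 + \<bar>t\<bar>) powr (- 1)) powr q / q"
        using p False q by (intro Youngs_inequality) auto
      also have "((1 + \<bar>t\<bar>) powr (- 1)) powr q = (1 + \<bar>t\<bar>) powr (- q)"
        by (subst powr_powr) simp
      finally have "cmod (f t) * (1 + \<bar>t\<bar>) powr (- 1) \<le> cmod (f t) powr p / p + (1 + \<bar>t\<bar>) powr (- q) / q" .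
      moreover have "norm (cmod (f t) / (1 + \<bar>t\<bar>)) = cmod (f t) * (1 + \<bar>t\<bar>) powr (- 1)"
        by (simp add: powr_minus divide_inverse)
      ultimately show "norm (cmod (f t) / (1 + \<bar>t\<bar>)) \<le> norm (cmod (f t) powr p / p + (1 + \<bar>t\<bar>) powr (- q) / q)"
        using p q by simp
    qed
  qed measurable
qed

text \<open>Since |1 - e^(-ist)| = 2 |sin(st/2)|, the numerator is at most 2 and at most |s t|. The
  first bound controls large t, the second the singularity at 0; the second plus |t| times the first
  gives one estimate of product form.\<close>

lemma norm_Psi_kernel_le: "cmod (Psi_kernel s t) \<le> (2 + \<bar>s\<bar>) / (1 + \<bar>t\<bar>)"
proof (cases "t = 0")
  case False
  define E where "E = 1 - exp (- (\<i> * of_real s * of_real t))"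
  have E_eq: "cmod E = 2 * \<bar>sin (s * t / 2)\<bar>"
    using dist_exp_i_1[of "- (s * t)"] by (simp add: E_def norm_minus_commute mult.assoc)
  have "cmod E \<le> 2"
    unfolding E_eq using abs_sin_le_one[of "s * t / 2"] by linarith
  moreover have "cmod E \<le> \<bar>s\<bar> * \<bar>t\<bar>"
    unfolding E_eq using abs_sin_x_le_abs_x[of "s * t / 2"] by (simp add: abs_mult)
  ultimately have "cmod E * 1 + cmod E * \<bar>t\<bar> \<le> \<bar>s\<bar> * \<bar>t\<bar> + 2 * \<bar>t\<bar>"
    by (intro add_mono mult_right_mono) auto
  then have "cmod E * (1 + \<bar>t\<bar>) \<le> (2 + \<bar>s\<bar>) * \<bar>t\<bar>"
    by (simp add: algebra_simps)
  moreover have "cmod (Psi_kernel s t) = cmod E / \<bar>t\<bar>"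
    using False by (simp add: Psi_kernel_def E_def norm_divide norm_mult)
  ultimately show ?thesis
    using False by (simp add: divide_le_eq le_divide_eq)
qed (simp add: Psi_kernel_def)

lemma Psi_kernel_measurable:
  "(\<lambda>(s, t). Psi_kernel s t) \<in> borel_measurable (borel \<Otimes>\<^sub>M borel)"
  unfolding Psi_kernel_def by measurable

lemma Psi_kernel_measurable' [measurable]: "Psi_kernel s \<in> borel_measurable borel"
  unfolding Psi_kernel_def by measurable

lemma norm_Psi_integrand_le:
  "cmod (Psi_kernel s t * z) \<le> (2 + \<bar>s\<bar>) * (cmod z / (1 + \<bar>t\<bar>))"
  using mult_right_mono[OF norm_Psi_kernel_le[of s t], of "cmod z"] by (simp add: norm_mult)

lemma Psi_integrable:
  assumes "1 \<le> p" "f \<in> Lp_fun p"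
  shows "integrable lebesgue (\<lambda>t. Psi_kernel s t * f t)"
proof (rule Bochner_Integration.integrable_bound)
  note [measurable] = Lp_funD(1)[OF assms(2)]
  have [measurable]: "Psi_kernel s \<in> borel_measurable lebesgue"
    by (rule measurable_completion) simp
  show "integrable lebesgue (\<lambda>t. (2 + \<bar>s\<bar>) * (cmod (f t) / (1 + \<bar>t\<bar>)))"
    using Lp_integrable_decay[OF assms] by (rule integrable_mult_right)
  show "(\<lambda>t. Psi_kernel s t * f t) \<in> borel_measurable lebesgue"
    by measurable
  show "AE t in lebesgue. norm (Psi_kernel s t * f t) \<le> norm ((2 + \<bar>s\<bar>) * (cmod (f t) / (1 + \<bar>t\<bar>)))"
    using norm_Psi_integrand_le[of s _ "f _"] by (intro AE_I2) (metis abs_ge_self order_trans real_norm_def)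
qed

lemma Psi_add:
  assumes "1 \<le> p" "f \<in> Lp_fun p" "g \<in> Lp_fun p"
  shows "Psi (\<lambda>t. f t + g t) s = Psi f s + Psi g s"
  using assms by (simp add: Psi_def distrib_left Psi_integrable)

lemma Psi_cmult: "Psi (\<lambda>t. c * f t) s = c * Psi f s"
  by (simp add: Psi_def mult.left_commute)

lemma Psi_cong_AE:
  assumes [measurable]: "f \<in> borel_measurable lebesgue" "g \<in> borel_measurable lebesgue"
    and "AE t in lebesgue. f t = g t"
  shows "Psi f = Psi g"
proof
  fix s
  have [measurable]: "Psi_kernel s \<in> borel_measurable lebesgue"
    by (rule measurable_completion) simp
  show "Psi f s = Psi g s"
    unfolding Psi_def using assms(3) by (intro integral_cong_AE) auto
qed

text \<open>The kernel estimate is a product, so \<open>s\<close> leaves the integral, and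
  \<open>C\<close> is a weighted integral of |f|, the same for all \<open>s\<close>.\<close>

lemma Psi_bound:
  assumes "1 \<le> p" "f \<in> Lp_fun p"
  obtains C where "0 \<le> C" "\<And>s. cmod (Psi f s) \<le> C * (2 + \<bar>s\<bar>)"
proof
  let ?C = "\<integral>t. cmod (f t) / (1 + \<bar>t\<bar>) \<partial>lebesgue"
  show "0 \<le> ?C"
    by (intro integral_nonneg_AE) auto
  show "cmod (Psi f s) \<le> ?C * (2 + \<bar>s\<bar>)" for s
  proof -
    have "cmod (Psi f s) \<le> (\<integral>t. (2 + \<bar>s\<bar>) * (cmod (f t) / (1 + \<bar>t\<bar>)) \<partial>lebesgue)"
      unfolding Psi_def
      by (intro order_trans[OF integral_norm_bound] integral_mono integrable_norm
          integrable_mult_right Psi_integrable[OF assms] Lp_integrable_decay[OF assms]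
          norm_Psi_integrand_le)
    then show ?thesis
      unfolding integral_mult_right_zero by (subst mult.commute)
  qed
qed

text \<open>Joint measurability on a product over \<open>lborel\<close> calls for Borel functions,
  whereas members of \<open>Lp_fun\<close> are measurable for the completion. The change on a null
  set is invisible to \<open>Psi\<close>.\<close>

lemma Lp_borel_representative:
  assumes f: "f \<in> Lp_fun p"
  obtains f' where "f' \<in> borel_measurable borel" "f' \<in> Lp_fun p" "AE t in lebesgue. f t = f' t"
proof -
  note [measurable] = Lp_funD(1)[OF f]
  have "(\<lambda>t. Re (f t)) \<in> borel_measurable lebesgue" "(\<lambda>t. Im (f t)) \<in> borel_measurable lebesgue"
    by measurable
  then obtain u v where uv: "u \<in> borel_measurable lborel" "AE t in lborel. Re (f t) = u t"
      "v \<in> borel_measurable lborel" "AE t in lborel. Im (f t) = v t"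
    using completion_ex_borel_measurable_real[of "\<lambda>t. Re (f t)" lborel]
      completion_ex_borel_measurable_real[of "\<lambda>t. Im (f t)" lborel] by blast
  define f' where "f' t = Complex (u t) (v t)" for t
  have f': "f' \<in> borel_measurable borel"
    using uv(1,3) unfolding f'_def Complex_eq by (auto intro: borel_measurable_add borel_measurable_times)
  then have [measurable]: "f' \<in> borel_measurable lebesgue"
    by (intro measurable_completion) simp
  have ae: "AE t in lebesgue. f t = f' t"
    using AE_completion[OF uv(2)] AE_completion[OF uv(4)]
    by eventually_elim (simp add: f'_def complex_eq_iff)
  have "integrable lebesgue (\<lambda>t. cmod (f' t) powr p)"
    using ae by (intro integrable_cong_AE_imp[OF Lp_funD(2)[OF f]]) auto
  then have "f' \<in> Lp_fun p"
    by (simp add: Lp_fun_def)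
  with f' ae show ?thesis
    by (intro that)
qed

text \<open>An integral depending on a parameter is measurable in it once the integrand is jointly
  Borel measurable, which the Borel representative arranges.\<close>

lemma Psi_borel_measurable:
  assumes "f \<in> Lp_fun p"
  shows "Psi f \<in> borel_measurable borel"
proof -
  obtain f' where f': "f' \<in> borel_measurable borel" "f' \<in> Lp_fun p" "AE t in lebesgue. f t = f' t"
    using Lp_borel_representative[OF assms] .
  note [measurable] = f'(1) Psi_kernel_measurable
  have "Psi f = Psi f'"
    using assms f' by (intro Psi_cong_AE) (auto dest: Lp_funD(1))
  also have "\<dots> = (\<lambda>s. \<integral>t. Psi_kernel s t * f' t \<partial>lborel)"
    unfolding Psi_def by (intro ext integral_completion) measurable
  also have "\<dots> \<in> borel_measurable borel"
    by measurable
  finally show ?thesis .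
qed

section \<open>Tempered distributions of at most linear growth\<close>

lemma vderiv_higher_linear:
  assumes "\<phi> \<in> schwartz" "\<psi> \<in> schwartz"
  shows "(vderiv ^^ k) (\<lambda>x. a * \<phi> x + b * \<psi> x) = (\<lambda>x. a * (vderiv ^^ k) \<phi> x + b * (vderiv ^^ k) \<psi> x)"
proof (induction k)
  case (Suc k)
  have "vderiv (\<lambda>x. a * (vderiv ^^ k) \<phi> x + b * (vderiv ^^ k) \<psi> x) x
      = a * vderiv ((vderiv ^^ k) \<phi>) x + b * vderiv ((vderiv ^^ k) \<psi>) x" for x
  proof -
    have "(vderiv ^^ k) \<phi> differentiable (at x)" "(vderiv ^^ k) \<psi> differentiable (at x)"
      using assms by (auto simp: schwartz_def)
    then show ?thesis
      unfolding vderiv_def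
      by (intro vector_derivative_at has_vector_derivative_add has_vector_derivative_mult_right)
         (simp_all flip: vector_derivative_works)
  qed
  then show ?case
    by (simp add: Suc fun_eq_iff)
qed simp

lemma schwartz_linear:
  assumes "\<phi> \<in> schwartz" "\<psi> \<in> schwartz"
  shows "(\<lambda>x. a * \<phi> x + b * \<psi> x) \<in> schwartz"
proof -
  have "(\<lambda>x. a * (vderiv ^^ k) \<phi> x + b * (vderiv ^^ k) \<psi> x) differentiable (at x)" for k x
    using assms by (auto simp: schwartz_def intro!: differentiable_add differentiable_mult)
  moreover have "bounded (range (\<lambda>x. x ^ m *\<^sub>R (a * (vderiv ^^ k) \<phi> x + b * (vderiv ^^ k) \<psi> x)))" for m k
  proof -
    have "bounded (range (\<lambda>x. x ^ m *\<^sub>R (vderiv ^^ k) \<phi> x))" "bounded (range (\<lambda>x. x ^ m *\<^sub>R (vderiv ^^ k) \<psi> x))"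
      using assms by (auto simp: schwartz_def)
    then obtain A B where "\<And>x. norm (x ^ m *\<^sub>R (vderiv ^^ k) \<phi> x) \<le> A" "\<And>x. norm (x ^ m *\<^sub>R (vderiv ^^ k) \<psi> x) \<le> B"
      unfolding bounded_iff by blast
    then have AB: "norm (a * (x ^ m *\<^sub>R (vderiv ^^ k) \<phi> x) + b * (x ^ m *\<^sub>R (vderiv ^^ k) \<psi> x)) \<le> cmod a * A + cmod b * B" for x
      by (intro order_trans[OF norm_triangle_ineq] add_mono) (auto simp only: norm_mult intro!: mult_left_mono norm_ge_zero)
    have "norm (x ^ m *\<^sub>R (a * (vderiv ^^ k) \<phi> x + b * (vderiv ^^ k) \<psi> x)) \<le> cmod a * A + cmod b * B" for x
      using AB[of x] by (simp add: scaleR_conv_of_real algebra_simps)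
    then show ?thesis
      unfolding bounded_iff by blast
  qed
  ultimately show ?thesis
    by (simp add: schwartz_def vderiv_higher_linear[OF assms])
qed

lemma vderiv_continuous:
  assumes "\<phi> \<in> schwartz"
  shows "continuous_on UNIV (vderiv \<phi>)"
proof (rule differentiable_imp_continuous_on)
  have "(vderiv ^^ 1) \<phi> differentiable (at x)" for x
    using assms unfolding schwartz_def by blast
  then show "vderiv \<phi> differentiable_on UNIV"
    by (simp add: differentiable_on_def)
qed

lemma vderiv_measurable [measurable]: "\<phi> \<in> schwartz \<Longrightarrow> vderiv \<phi> \<in> borel_measurable borel"
  by (intro borel_measurable_continuous_onI vderiv_continuous)

lemma integrable_lborel_inverse_square: "integrable lborel (\<lambda>t::real. 1 / (1 + \<bar>t\<bar>)\<^sup>2)"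
  using integrable_lborel_one_plus_abs_powr[of 2] by (simp add: powr_minus_divide)

text \<open>(2 + x)(1 + x)^2 = 2 + 5x + 4x^2 + x^3, which explains the powers up to 3, and the
  coefficients add up to 12. The factor 2 + |s| is reserved for the growth of \<open>Psi f\<close>;
  the inverse square that remains is integrable.\<close>

lemma polynomial_decay:
  fixes z :: complex
  assumes "\<And>m. m \<le> 3 \<Longrightarrow> norm (s ^ m *\<^sub>R z) \<le> e"
  shows "(2 + \<bar>s\<bar>) * cmod z \<le> 12 * e * (1 / (1 + \<bar>s\<bar>)\<^sup>2)"
proof -
  have "cmod z \<le> e" "\<bar>s\<bar> * cmod z \<le> e" "\<bar>s\<bar>\<^sup>2 * cmod z \<le> e" "\<bar>s\<bar> ^ 3 * cmod z \<le> e"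
    using assms[of 0] assms[of 1] assms[of 2] assms[of 3] by (simp_all add: power_abs)
  then have "2 * cmod z + 5 * (\<bar>s\<bar> * cmod z) + 4 * (\<bar>s\<bar>\<^sup>2 * cmod z) + \<bar>s\<bar> ^ 3 * cmod z \<le> 12 * e"
    by linarith
  then have "(2 + \<bar>s\<bar>) * cmod z * (1 + \<bar>s\<bar>)\<^sup>2 \<le> 12 * e"
    by (simp add: power2_eq_square power3_eq_cube algebra_simps)
  moreover have "0 < (1 + \<bar>s\<bar>)\<^sup>2"
    by (intro zero_less_power) linarith
  ultimately show ?thesis
    by (simp add: pos_le_divide_eq)
qed

lemma schwartz_decay:
  assumes "\<phi> \<in> schwartz"
  obtains B where "\<And>s. (2 + \<bar>s\<bar>) * cmod ((vderiv ^^ k) \<phi> s) \<le> B * (1 / (1 + \<bar>s\<bar>)\<^sup>2)"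
proof -
  have "bounded (range (\<lambda>x. x ^ m *\<^sub>R (vderiv ^^ k) \<phi> x))" for m
    using assms unfolding schwartz_def by blast
  then have "\<exists>A. \<forall>x. norm (x ^ m *\<^sub>R (vderiv ^^ k) \<phi> x) \<le> A" for m
    unfolding bounded_iff by blast
  then obtain A where A: "\<And>m x. norm (x ^ m *\<^sub>R (vderiv ^^ k) \<phi> x) \<le> A m"
    by metis
  have "norm (s ^ m *\<^sub>R (vderiv ^^ k) \<phi> s) \<le> Max (A ` {..3})" if "m \<le> 3" for m s
    using that by (intro order_trans[OF A Max_ge]) auto
  from polynomial_decay[OF this] show ?thesis
    by (rule that)
qed

lemma integrable_growth_vderiv:
  assumes F: "F \<in> borel_measurable borel" "0 \<le> C" "\<And>s. cmod (F s) \<le> C * (2 + \<bar>s\<bar>)"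
    and \<phi>: "\<phi> \<in> schwartz"
  shows "integrable lborel (\<lambda>s. F s * vderiv \<phi> s)"
proof -
  obtain B where B: "\<And>s. (2 + \<bar>s\<bar>) * cmod (vderiv \<phi> s) \<le> B * (1 / (1 + \<bar>s\<bar>)\<^sup>2)"
    using schwartz_decay[OF \<phi>, of 1] by auto
  note [measurable] = F(1) vderiv_measurable[OF \<phi>]
  show ?thesis
  proof (rule Bochner_Integration.integrable_bound)
    show "integrable lborel (\<lambda>s. C * (B * (1 / (1 + \<bar>s\<bar>)\<^sup>2)))"
      by (intro integrable_mult_right integrable_lborel_inverse_square)
    show "AE s in lborel. norm (F s * vderiv \<phi> s) \<le> norm (C * (B * (1 / (1 + \<bar>s\<bar>)\<^sup>2)))"
    proof (rule AE_I2)
      fix s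
      have "norm (F s * vderiv \<phi> s) \<le> C * (2 + \<bar>s\<bar>) * cmod (vderiv \<phi> s)"
        unfolding norm_mult by (intro mult_right_mono F) simp
      also have "\<dots> \<le> C * (B * (1 / (1 + \<bar>s\<bar>)\<^sup>2))"
        unfolding mult.assoc by (intro mult_left_mono B F)
      finally show "norm (F s * vderiv \<phi> s) \<le> norm (C * (B * (1 / (1 + \<bar>s\<bar>)\<^sup>2)))"
        by (rule order_trans) (simp only: real_norm_def abs_ge_self)
    qed
  qed measurable
qed

lemma distr_deriv_lborel:
  assumes "F \<in> borel_measurable borel" "\<phi> \<in> schwartz"
  shows "distr_deriv F \<phi> = - (\<integral>s. F s * vderiv \<phi> s \<partial>lborel)"
proof -
  note [measurable] = assms(1) vderiv_measurable[OF assms(2)]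
  have "(\<lambda>s. F s * vderiv \<phi> s) \<in> borel_measurable lborel"
    by measurable
  then show ?thesis
    using assms(2) by (simp add: distr_deriv_def integral_completion)
qed

text \<open>Continuity is controlled by four seminorms, those of the first derivative with weights
  x^0 to x^3: if all of them are below \<open>e\<close> for the difference of two test functions,
  the integrand is at most \<open>e\<close> times a fixed integrable function.\<close>

lemma distr_deriv_tempered:
  assumes F: "F \<in> borel_measurable borel" "0 \<le> C" "\<And>s. cmod (F s) \<le> C * (2 + \<bar>s\<bar>)"
  shows "distr_deriv F \<in> tempered_distributions"
  unfolding tempered_distributions_def
proof (intro CollectI conjI ballI allI impI)
  note int = integrable_growth_vderiv[OF F]
  show "distr_deriv F (\<lambda>x. a * \<phi> x + b * \<psi> x) = a * distr_deriv F \<phi> + b * distr_deriv F \<psi>"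
    if "\<phi> \<in> schwartz" "\<psi> \<in> schwartz" for \<phi> \<psi> a b
  proof -
    have "(\<integral>s. F s * vderiv (\<lambda>x. a * \<phi> x + b * \<psi> x) s \<partial>lborel)
        = (\<integral>s. a * (F s * vderiv \<phi> s) + b * (F s * vderiv \<psi> s) \<partial>lborel)"
      using vderiv_higher_linear[OF that, of 1 a b] by (simp add: algebra_simps)
    also have "\<dots> = a * (\<integral>s. F s * vderiv \<phi> s \<partial>lborel) + b * (\<integral>s. F s * vderiv \<psi> s \<partial>lborel)"
      using int that by simp
    finally show ?thesis
      using that by (simp add: distr_deriv_lborel[OF F(1)] schwartz_linear)
  qed
  show "(\<lambda>n. distr_deriv F (\<phi> n)) \<longlonglongrightarrow> distr_deriv F \<psi>"
    if \<phi>: "\<forall>n. \<phi> n \<in> schwartz" and \<psi>: "\<psi> \<in> schwartz" and lim: "schwartz_lim \<phi> \<psi>" for \<phi> \<psi>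
  proof -
    let ?J = "\<integral>s. 1 / (1 + \<bar>s\<bar>)\<^sup>2 \<partial>(lborel :: real measure)"
    have bound: "eventually (\<lambda>n. norm (distr_deriv F (\<phi> n) - distr_deriv F \<psi>) \<le> C * (12 * e * ?J)) sequentially"
      if e: "0 < e" for e
    proof -
      have "eventually (\<lambda>n. \<forall>x. dist (x ^ m *\<^sub>R vderiv (\<phi> n) x) (x ^ m *\<^sub>R vderiv \<psi> x) < e) sequentially" for m
      proof -
        have "uniform_limit UNIV (\<lambda>n x. x ^ m *\<^sub>R (vderiv ^^ 1) (\<phi> n) x) (\<lambda>x. x ^ m *\<^sub>R (vderiv ^^ 1) \<psi> x) sequentially"
          using lim unfolding schwartz_lim_def by blast
        then show ?thesis
          using e by (simp add: uniform_limit_iff)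
      qed
      then have "eventually (\<lambda>n. \<forall>m\<in>{..3}. \<forall>x. dist (x ^ m *\<^sub>R vderiv (\<phi> n) x) (x ^ m *\<^sub>R vderiv \<psi> x) < e) sequentially"
        by (intro eventually_ball_finite) auto
      then show ?thesis
      proof eventually_elim
        fix n assume n: "\<forall>m\<in>{..3}. \<forall>x. dist (x ^ m *\<^sub>R vderiv (\<phi> n) x) (x ^ m *\<^sub>R vderiv \<psi> x) < e"
        have decay: "(2 + \<bar>s\<bar>) * cmod (vderiv \<psi> s - vderiv (\<phi> n) s) \<le> 12 * e * (1 / (1 + \<bar>s\<bar>)\<^sup>2)" for s
          using n by (intro polynomial_decay)
            (auto simp: dist_norm norm_minus_commute less_imp_le simp flip: scaleR_diff_right)
        have "distr_deriv F (\<phi> n) - distr_deriv F \<psi>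
            = (\<integral>s. F s * vderiv \<psi> s - F s * vderiv (\<phi> n) s \<partial>lborel)"
          using int \<phi> \<psi> by (simp add: distr_deriv_lborel[OF F(1)])
        also have "norm \<dots> \<le> (\<integral>s. norm (F s * vderiv \<psi> s - F s * vderiv (\<phi> n) s) \<partial>lborel)"
          by (rule integral_norm_bound)
        also have "\<dots> \<le> (\<integral>s. C * (12 * e * (1 / (1 + \<bar>s\<bar>)\<^sup>2)) \<partial>lborel)"
        proof (rule integral_mono)
          fix s
          have "norm (F s * vderiv \<psi> s - F s * vderiv (\<phi> n) s) = cmod (F s) * cmod (vderiv \<psi> s - vderiv (\<phi> n) s)"
            by (simp flip: right_diff_distrib norm_mult)
          also have "\<dots> \<le> C * (2 + \<bar>s\<bar>) * cmod (vderiv \<psi> s - vderiv (\<phi> n) s)"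
            by (intro mult_right_mono F) simp
          also have "\<dots> \<le> C * (12 * e * (1 / (1 + \<bar>s\<bar>)\<^sup>2))"
            unfolding mult.assoc[of C] by (intro mult_left_mono decay F)
          finally show "norm (F s * vderiv \<psi> s - F s * vderiv (\<phi> n) s) \<le> C * (12 * e * (1 / (1 + \<bar>s\<bar>)\<^sup>2))" .
        qed (use int \<phi> \<psi> in \<open>intro integrable_norm Bochner_Integration.integrable_diff
              integrable_mult_right integrable_lborel_inverse_square; blast\<close>)+
        also have "\<dots> = C * (12 * e * ?J)"
          by (simp only: integral_mult_right_zero)
        finally show "norm (distr_deriv F (\<phi> n) - distr_deriv F \<psi>) \<le> C * (12 * e * ?J)" .
      qed
    qed
    have J: "0 \<le> ?J"
      by (intro integral_nonneg_AE) auto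
    show ?thesis
    proof (rule tendstoI)
      fix e :: real assume e: "0 < e"
      \<comment> \<open>The summand 1 keeps the denominator positive when \<open>C\<close> or the
        integral vanishes, and makes the resulting inequality strict.\<close>
      define d where "d = e / (C * 12 * ?J + 1)"
      have pos: "0 < C * 12 * ?J + 1"
        using J F(2) by (intro add_nonneg_pos) auto
      then have d: "0 < d"
        using e by (simp add: d_def)
      have "C * (12 * d * ?J) < d * (C * 12 * ?J + 1)"
        using d by (simp add: algebra_simps)
      also have "\<dots> = e"
        using pos by (simp add: d_def)
      finally have "C * (12 * d * ?J) < e" .
      then show "eventually (\<lambda>n. dist (distr_deriv F (\<phi> n)) (distr_deriv F \<psi>) < e) sequentially"
        using bound[OF d] by (auto simp: dist_norm elim!: eventually_mono)
    qed
  qed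
  show "distr_deriv F \<phi> = 0" if "\<phi> \<notin> schwartz" for \<phi>
    using that by (simp add: distr_deriv_def)
qed

section \<open>The derivative as a Fourier transform\<close>

text \<open>The kernel is the antiderivative of e^(-ist) in s that vanishes at s = 0, and its value
  at t = 0 is the one for which this persists. Integration by parts therefore replaces it by the
  Fourier kernel.\<close>

lemma Psi_kernel_has_vector_derivative:
  "((\<lambda>s. Psi_kernel s t) has_vector_derivative exp (- (\<i> * of_real s * of_real t))) (at s)"
proof (cases "t = 0")
  case True
  then show ?thesis
    by (auto simp: Psi_kernel_def intro!: derivative_eq_intros)
next
  case False
  have "((\<lambda>z. (1 - exp (- (\<i> * z * of_real t))) / (\<i> * of_real t)) has_field_derivative
      exp (- (\<i> * of_real s * of_real t))) (at (of_real s))"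
    using False by (auto intro!: derivative_eq_intros)
  then show ?thesis
    using False by (auto dest: has_vector_derivative_real_field simp: Psi_kernel_def)
qed

lemma decay_tendsto_zero:
  fixes G :: "real \<Rightarrow> complex"
  assumes "\<And>s. cmod (G s) \<le> B * (1 / (1 + \<bar>s\<bar>)\<^sup>2)"
  shows "(G \<longlongrightarrow> 0) at_top" "(G \<longlongrightarrow> 0) at_bot"
proof -
  have "((\<lambda>s. B * (1 / (1 + \<bar>s\<bar>)\<^sup>2)) \<longlongrightarrow> 0) at_top" "((\<lambda>s. B * (1 / (1 + \<bar>s\<bar>)\<^sup>2)) \<longlongrightarrow> 0) at_bot"
    by real_asymp+
  then show "(G \<longlongrightarrow> 0) at_top" "(G \<longlongrightarrow> 0) at_bot"
    by (auto intro!: Lim_null_comparison[of G] always_eventually assms)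
qed

lemma schwartz_vector_derivative:
  assumes "\<phi> \<in> schwartz"
  shows "(\<phi> has_vector_derivative vderiv \<phi> s) (at s)"
proof -
  have "(vderiv ^^ 0) \<phi> differentiable (at s)"
    using assms unfolding schwartz_def by blast
  then show ?thesis
    by (simp add: vderiv_def vector_derivative_works)
qed

lemma schwartz_isCont: "\<phi> \<in> schwartz \<Longrightarrow> isCont \<phi> s"
  using schwartz_vector_derivative has_vector_derivative_continuous by blast

lemma schwartz_measurable: "\<phi> \<in> schwartz \<Longrightarrow> \<phi> \<in> borel_measurable borel"
  by (intro borel_measurable_continuous_onI continuous_at_imp_continuous_on) (auto intro: schwartz_isCont)

lemma integrable_decay:
  fixes G :: "real \<Rightarrow> complex"
  assumes "G \<in> borel_measurable borel" "\<And>s. cmod (G s) \<le> B * (1 / (1 + \<bar>s\<bar>)\<^sup>2)"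
  shows "integrable lborel G"
proof (rule Bochner_Integration.integrable_bound)
  show "integrable lborel (\<lambda>s. B * (1 / (1 + \<bar>s\<bar>)\<^sup>2))"
    by (intro integrable_mult_right integrable_lborel_inverse_square)
  show "AE s in lborel. norm (G s) \<le> norm (B * (1 / (1 + \<bar>s\<bar>)\<^sup>2))"
    using assms(2) by (intro AE_I2) (metis abs_ge_self order_trans real_norm_def)
qed (use assms(1) in simp)

lemma Psi_kernel_by_parts:
  assumes \<phi>: "\<phi> \<in> schwartz"
  shows "(\<integral>s. Psi_kernel s t * vderiv \<phi> s \<partial>lborel)
       = - (\<integral>s. exp (- (\<i> * of_real s * of_real t)) * \<phi> s \<partial>lborel)"
proof -
  let ?K = "\<lambda>s. Psi_kernel s t" and ?E = "\<lambda>s. exp (- (\<i> * complex_of_real s * of_real t))"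
  obtain A where A: "\<And>s. (2 + \<bar>s\<bar>) * cmod (\<phi> s) \<le> A * (1 / (1 + \<bar>s\<bar>)\<^sup>2)"
    using schwartz_decay[OF \<phi>, of 0] by auto
  obtain B where B: "\<And>s. (2 + \<bar>s\<bar>) * cmod (vderiv \<phi> s) \<le> B * (1 / (1 + \<bar>s\<bar>)\<^sup>2)"
    using schwartz_decay[OF \<phi>, of 1] by auto
  note [measurable] = schwartz_measurable[OF \<phi>] vderiv_measurable[OF \<phi>]
  have [measurable]: "?K \<in> borel_measurable borel"
    unfolding Psi_kernel_def by measurable
  \<comment> \<open>Here t is fixed and only the growth in s counts, so the factor 1 / (1 + |t|) is
    bounded by 1.\<close>
  have K_le: "cmod (?K s) \<le> 2 + \<bar>s\<bar>" for s
    by (rule order_trans[OF norm_Psi_kernel_le]) (use divide_left_mono[of 1 "1 + \<bar>t\<bar>" "2 + \<bar>s\<bar>"] in simp)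
  have K_phi: "cmod (?K s * \<phi> s) \<le> A * (1 / (1 + \<bar>s\<bar>)\<^sup>2)" for s
    unfolding norm_mult by (intro order_trans[OF mult_right_mono[OF K_le] A]) simp
  have int1: "integrable lborel (\<lambda>s. ?K s * vderiv \<phi> s)"
  proof (rule integrable_decay)
    show "cmod (?K s * vderiv \<phi> s) \<le> B * (1 / (1 + \<bar>s\<bar>)\<^sup>2)" for s
      unfolding norm_mult by (intro order_trans[OF mult_right_mono[OF K_le] B]) simp
  qed measurable
  have int2: "integrable lborel (\<lambda>s. ?E s * \<phi> s)"
  proof (rule integrable_decay)
    show "cmod (?E s * \<phi> s) \<le> A * (1 / (1 + \<bar>s\<bar>)\<^sup>2)" for s
    proof -
      have "cmod (?E s * \<phi> s) = 1 * cmod (\<phi> s)"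
        by (simp add: norm_mult)
      also have "\<dots> \<le> (2 + \<bar>s\<bar>) * cmod (\<phi> s)"
        by (intro mult_right_mono) auto
      finally show ?thesis
        using A[of s] by linarith
    qed
  qed measurable
  \<comment> \<open>The integrand is the derivative of \<open>?K s * \<phi> s\<close>, which tends
    to 0 at both ends because Schwartz decay beats the linear growth of \<open>?K\<close>.\<close>
  have "(LBINT s=-\<infinity>..\<infinity>. ?K s * vderiv \<phi> s + ?E s * \<phi> s) = 0 - 0"
  proof (rule interval_integral_FTC_integrable)
    show "((\<lambda>s. ?K s * \<phi> s) has_vector_derivative ?K s * vderiv \<phi> s + ?E s * \<phi> s) (at s)" for s
      by (intro has_vector_derivative_mult Psi_kernel_has_vector_derivative schwartz_vector_derivative \<phi>)
    show "isCont (\<lambda>s. ?K s * vderiv \<phi> s + ?E s * \<phi> s) s" for s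
    proof -
      have "isCont ?K s"
        using Psi_kernel_has_vector_derivative has_vector_derivative_continuous by blast
      moreover have "isCont (vderiv \<phi>) s"
        using vderiv_continuous[OF \<phi>] by (simp add: continuous_on_eq_continuous_at)
      ultimately show ?thesis
        using schwartz_isCont[OF \<phi>, of s] by (intro continuous_intros)
    qed
    show "set_integrable lborel (einterval (- \<infinity>) \<infinity>) (\<lambda>s. ?K s * vderiv \<phi> s + ?E s * \<phi> s)"
      using int1 int2 by (simp add: set_integrable_def)
    show "(((\<lambda>s. ?K s * \<phi> s) \<circ> real_of_ereal) \<longlongrightarrow> 0) (at_right (- \<infinity>))"
      "(((\<lambda>s. ?K s * \<phi> s) \<circ> real_of_ereal) \<longlongrightarrow> 0) (at_left \<infinity>)"
      unfolding ereal_tendsto_simps by (intro decay_tendsto_zero[OF K_phi])+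
  qed simp
  then have "(\<integral>s. ?K s * vderiv \<phi> s + ?E s * \<phi> s \<partial>lborel) = 0"
    by (simp add: interval_lebesgue_integral_def set_lebesgue_integral_def)
  then show ?thesis
    using int1 int2 by (simp add: eq_neg_iff_add_eq_0)
qed

lemma integrable_lborel_pair_mult:
  fixes g h :: "real \<Rightarrow> real"
  assumes "integrable lborel g" "integrable lborel h"
  shows "integrable (lborel \<Otimes>\<^sub>M lborel) (\<lambda>(s, t). g s * h t)"
proof (rule lborel_pair.Fubini_integrable)
  note [measurable] = borel_measurable_integrable[OF assms(1)] borel_measurable_integrable[OF assms(2)]
  show "(\<lambda>(s, t). g s * h t) \<in> borel_measurable (lborel \<Otimes>\<^sub>M lborel)"
    by measurable
qed (use assms in \<open>auto simp: abs_mult\<close>)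

text \<open>Fubini swaps the pairing with the derivative of \<phi> and the integral over t; the
  integration by parts then takes place for each fixed t. The Fourier transform thus falls on
  \<phi>, where it is an ordinary integral.\<close>

lemma distr_deriv_Psi:
  assumes p: "1 \<le> p" and f: "f \<in> Lp_fun p" "f \<in> borel_measurable borel" and \<phi>: "\<phi> \<in> schwartz"
  shows "distr_deriv (Psi f) \<phi>
       = (\<integral>t. f t * (\<integral>s. exp (- (\<i> * of_real s * of_real t)) * \<phi> s \<partial>lborel) \<partial>lborel)"
proof -
  note [measurable] = f(2) schwartz_measurable[OF \<phi>] vderiv_measurable[OF \<phi>] Psi_kernel_measurable
  obtain B where B: "\<And>s. (2 + \<bar>s\<bar>) * cmod (vderiv \<phi> s) \<le> B * (1 / (1 + \<bar>s\<bar>)\<^sup>2)"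
    using schwartz_decay[OF \<phi>, of 1] by auto
  have g: "integrable lborel (\<lambda>s. (2 + \<bar>s\<bar>) * cmod (vderiv \<phi> s))"
  proof -
    have "integrable lborel (\<lambda>s. complex_of_real ((2 + \<bar>s\<bar>) * cmod (vderiv \<phi> s)))"
      by (rule integrable_decay[of _ B]) (measurable, use B in \<open>simp del: of_real_mult of_real_add\<close>)
    then show ?thesis
      by (simp only: complex_of_real_integrable_eq)
  qed
  have h: "integrable lborel (\<lambda>t. cmod (f t) / (1 + \<bar>t\<bar>))"
    using Lp_integrable_decay[OF p f(1)] by (subst (asm) integrable_completion) auto
  \<comment> \<open>By the product form of the kernel bound, the majorant is an integrable function
    of \<open>s\<close> times an integrable function of \<open>t\<close>.\<close>
  have fub: "integrable (lborel \<Otimes>\<^sub>M lborel) (\<lambda>(s, t). Psi_kernel s t * f t * vderiv \<phi> s)"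
  proof (rule Bochner_Integration.integrable_bound[OF integrable_lborel_pair_mult[OF g h]])
    show "(\<lambda>(s, t). Psi_kernel s t * f t * vderiv \<phi> s) \<in> borel_measurable (lborel \<Otimes>\<^sub>M lborel)"
      by measurable
    have "norm (Psi_kernel s t * f t * vderiv \<phi> s)
        \<le> norm ((2 + \<bar>s\<bar>) * cmod (vderiv \<phi> s) * (cmod (f t) / (1 + \<bar>t\<bar>)))" for s t
      using mult_right_mono[OF norm_Psi_integrand_le[of s t "f t"], of "cmod (vderiv \<phi> s)"]
      by (simp add: norm_mult abs_mult ac_simps)
    then show "AE x in lborel \<Otimes>\<^sub>M lborel. norm (case x of (s, t) \<Rightarrow> Psi_kernel s t * f t * vderiv \<phi> s)
        \<le> norm (case x of (s, t) \<Rightarrow> (2 + \<bar>s\<bar>) * cmod (vderiv \<phi> s) * (cmod (f t) / (1 + \<bar>t\<bar>)))"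
      by (intro AE_I2) (auto split: prod.split)
  qed
  have "distr_deriv (Psi f) \<phi> = - (\<integral>s. Psi f s * vderiv \<phi> s \<partial>lborel)"
    by (rule distr_deriv_lborel[OF Psi_borel_measurable[OF f(1)] \<phi>])
  also have "(\<integral>s. Psi f s * vderiv \<phi> s \<partial>lborel) = (\<integral>s. (\<integral>t. Psi_kernel s t * f t * vderiv \<phi> s \<partial>lborel) \<partial>lborel)"
  proof -
    have "Psi f s = (\<integral>t. Psi_kernel s t * f t \<partial>lborel)" for s
      unfolding Psi_def by (intro integral_completion) measurable
    then show ?thesis
      by simp
  qed
  also have "\<dots> = (\<integral>t. (\<integral>s. Psi_kernel s t * f t * vderiv \<phi> s \<partial>lborel) \<partial>lborel)"
    by (rule lborel_pair.Fubini_integral[OF fub, symmetric])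
  also have "\<dots> = (\<integral>t. f t * (\<integral>s. Psi_kernel s t * vderiv \<phi> s \<partial>lborel) \<partial>lborel)"
    by (simp add: mult.assoc mult.left_commute[of _ "f _"])
  finally show ?thesis
    by (simp add: Psi_kernel_by_parts[OF \<phi>])
qed

section \<open>Gaussian test functions and their Fourier transforms\<close>

definition gauss :: "real \<Rightarrow> real \<Rightarrow> complex" where
  "gauss a s = of_real (exp (- ((s - a)\<^sup>2 / 2)))"

text \<open>A single term of the exponential series gives |x|^i \<le> i! e^|x|. By |x| \<le> |a| +
  |x - a| and 2 |x - a| \<le> (x - a)^2 + 1, the exponent |x| - (x - a)^2 / 2 is at most |a| +
  1/2.\<close>

lemma power_gauss_le:
  fixes x a :: real
  shows "\<bar>x ^ i * exp (- ((x - a)\<^sup>2 / 2))\<bar> \<le> fact i * exp (\<bar>a\<bar> + 1 / 2)"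
proof -
  have "(\<Sum>n\<in>{i}. \<bar>x\<bar> ^ n / fact n) \<le> (\<Sum>n. \<bar>x\<bar> ^ n / fact n)"
    using summable_exp[of "\<bar>x\<bar>"] by (intro sum_le_suminf) (auto simp: divide_inverse mult.commute)
  then have "\<bar>x\<bar> ^ i / fact i \<le> exp \<bar>x\<bar>"
    by (simp add: exp_def divide_inverse mult.commute)
  then have pow: "\<bar>x\<bar> ^ i \<le> fact i * exp \<bar>x\<bar>"
    by (simp add: divide_le_eq mult.commute)
  define q where "q = (x - a)\<^sup>2"
  have "0 \<le> (\<bar>x - a\<bar> - 1)\<^sup>2"
    by simp
  then have "2 * \<bar>x - a\<bar> \<le> q + 1"
    by (simp add: power2_diff q_def)
  then have "\<bar>x\<bar> + - (q / 2) \<le> \<bar>a\<bar> + 1 / 2"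
    by argo
  then have "exp \<bar>x\<bar> * exp (- (q / 2)) \<le> exp (\<bar>a\<bar> + 1 / 2)"
    unfolding exp_add[symmetric] by (simp only: exp_le_cancel_iff)
  then have "fact i * (exp \<bar>x\<bar> * exp (- (q / 2))) \<le> fact i * exp (\<bar>a\<bar> + 1 / 2)"
    by (rule mult_left_mono) simp
  moreover have "\<bar>x\<bar> ^ i * exp (- (q / 2)) \<le> fact i * exp \<bar>x\<bar> * exp (- (q / 2))"
    by (rule mult_right_mono[OF pow]) simp
  ultimately have "\<bar>x\<bar> ^ i * exp (- (q / 2)) \<le> fact i * exp (\<bar>a\<bar> + 1 / 2)"
    by (simp only: mult.assoc)
  then show ?thesis
    by (simp add: abs_mult power_abs q_def)
qed

lemma poly_gauss_bounded: "bounded (range (\<lambda>x. complex_of_real (poly P x * exp (- ((x - a)\<^sup>2 / 2)))))"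
proof -
  have "norm (complex_of_real (poly P x * exp (- ((x - a)\<^sup>2 / 2))))
      \<le> (\<Sum>i\<le>Polynomial.degree P. \<bar>Polynomial.coeff P i\<bar> * (fact i * exp (\<bar>a\<bar> + 1 / 2)))" for x
  proof -
    have "norm (complex_of_real (poly P x * exp (- ((x - a)\<^sup>2 / 2))))
        = \<bar>\<Sum>i\<le>Polynomial.degree P. Polynomial.coeff P i * (x ^ i * exp (- ((x - a)\<^sup>2 / 2)))\<bar>"
      unfolding norm_of_real by (simp add: poly_altdef sum_distrib_right mult.assoc)
    also have "\<dots> \<le> (\<Sum>i\<le>Polynomial.degree P. \<bar>Polynomial.coeff P i * (x ^ i * exp (- ((x - a)\<^sup>2 / 2)))\<bar>)"
      by (rule sum_abs)
    also have "\<dots> \<le> (\<Sum>i\<le>Polynomial.degree P. \<bar>Polynomial.coeff P i\<bar> * (fact i * exp (\<bar>a\<bar> + 1 / 2)))"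
      unfolding abs_mult[of "Polynomial.coeff _ _"] by (intro sum_mono mult_left_mono power_gauss_le) simp
    finally show ?thesis .
  qed
  then show ?thesis
    unfolding bounded_iff by blast
qed

text \<open>The factor \<open>[:a, -1:]\<close> is a - x, the derivative of the exponent. Polynomial
  multiples of the Gaussian are thus closed under differentiation; powers of x are absorbed as well,
  so all Schwartz seminorms reduce to one boundedness statement.\<close>

lemma poly_gauss_has_vector_derivative:
  "((\<lambda>x. complex_of_real (poly P x * exp (- ((x - a)\<^sup>2 / 2)))) has_vector_derivative
     complex_of_real (poly (pderiv P + [:a, -1:] * P) x * exp (- ((x - a)\<^sup>2 / 2)))) (at x)"
proof -
  have "((\<lambda>x. poly P x * exp (- ((x - a)\<^sup>2 / 2))) has_real_derivative
     poly (pderiv P + [:a, -1:] * P) x * exp (- ((x - a)\<^sup>2 / 2))) (at x)"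
    by (auto intro!: derivative_eq_intros simp: algebra_simps)
  then show ?thesis
    by (intro has_vector_derivative_of_real) (simp add: has_real_derivative_iff_has_vector_derivative)
qed

lemma vderiv_higher_gauss:
  "\<exists>P. (vderiv ^^ k) (gauss a) = (\<lambda>x. complex_of_real (poly P x * exp (- ((x - a)\<^sup>2 / 2))))"
proof (induction k)
  case 0
  then show ?case
    by (intro exI[of _ 1]) (simp add: gauss_def fun_eq_iff)
next
  case (Suc k)
  then obtain P where P: "(vderiv ^^ k) (gauss a) = (\<lambda>x. complex_of_real (poly P x * exp (- ((x - a)\<^sup>2 / 2))))"
    by blast
  have "(vderiv ^^ Suc k) (gauss a) = vderiv (\<lambda>x. complex_of_real (poly P x * exp (- ((x - a)\<^sup>2 / 2))))"
    unfolding funpow.simps comp_def P ..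
  also have "\<dots> = (\<lambda>x. complex_of_real (poly (pderiv P + [:a, -1:] * P) x * exp (- ((x - a)\<^sup>2 / 2))))"
    unfolding vderiv_def by (intro ext vector_derivative_at poly_gauss_has_vector_derivative)
  finally show ?case ..
qed

lemma gauss_schwartz: "gauss a \<in> schwartz"
  unfolding schwartz_def
proof (intro CollectI conjI allI)
  fix k m :: nat
  obtain P where P: "(vderiv ^^ k) (gauss a) = (\<lambda>x. complex_of_real (poly P x * exp (- ((x - a)\<^sup>2 / 2))))"
    using vderiv_higher_gauss by blast
  show "(vderiv ^^ k) (gauss a) differentiable (at x)" for x
    unfolding P using poly_gauss_has_vector_derivative by (rule differentiableI_vector)
  have "(\<lambda>x. x ^ m *\<^sub>R (vderiv ^^ k) (gauss a) x)
      = (\<lambda>x. complex_of_real (poly (Polynomial.monom 1 m * P) x * exp (- ((x - a)\<^sup>2 / 2))))"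
    by (simp add: P fun_eq_iff poly_monom scaleR_conv_of_real)
  then show "bounded (range (\<lambda>x. x ^ m *\<^sub>R (vderiv ^^ k) (gauss a) x))"
    by (simp only: poly_gauss_bounded)
qed

text \<open>Shifting by \<open>a\<close> becomes modulation by e^(-iat), while the Gaussian factor
  in t is the same for all \<open>a\<close>. That factor is the characteristic function of the
  standard normal distribution, and sqrt(2 pi) undoes the normalisation of its density.\<close>

lemma fourier_gauss:
  "(\<integral>s. exp (- (\<i> * of_real s * of_real t)) * gauss a s \<partial>lborel)
     = of_real (sqrt (2 * pi) * exp (- t\<^sup>2 / 2)) * exp (\<i> * of_real (- a * t))"
proof -
  have "(\<integral>s. exp (- (\<i> * of_real s * of_real t)) * gauss a s \<partial>lborel)
      = (\<integral>x. exp (- (\<i> * of_real (a + 1 * x) * of_real t)) * gauss a (a + 1 * x) \<partial>lborel)"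
    using lborel_integral_real_affine[of 1 "\<lambda>s. exp (- (\<i> * of_real s * of_real t)) * gauss a s" a] by simp
  also have "\<dots> = (\<integral>x. of_real (sqrt (2 * pi)) * exp (\<i> * of_real (- a * t)) *
      (std_normal_density x *\<^sub>R exp (\<i> * of_real (- t * x))) \<partial>lborel)"
    by (intro Bochner_Integration.integral_cong refl)
       (simp add: gauss_def std_normal_density_def scaleR_conv_of_real exp_add[symmetric] algebra_simps
          flip: exp_of_real)
  also have "\<dots> = of_real (sqrt (2 * pi)) * exp (\<i> * of_real (- a * t)) *
      (\<integral>x. std_normal_density x *\<^sub>R exp (\<i> * of_real (- t * x)) \<partial>lborel)"
    by (rule integral_mult_right_zero)
  also have "(\<integral>x. std_normal_density x *\<^sub>R exp (\<i> * of_real (- t * x)) \<partial>lborel) = char std_normal_distribution (- t)"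
    unfolding char_def by (intro integral_density[symmetric]) auto
  also have "\<dots> = of_real (exp (- t\<^sup>2 / 2))"
    by (simp add: char_std_normal_distribution)
  finally show ?thesis
    by simp
qed

section \<open>Injectivity\<close>

text \<open>The positive and negative parts of \<open>h\<close> have the same transform. Divided by
  their common mass \<open>c\<close> they are densities of probability measures with equal
  characteristic functions; if \<open>c\<close> is 0, both parts vanish almost everywhere.\<close>

lemma fourier_unique_real:
  fixes h :: "real \<Rightarrow> real"
  assumes h: "integrable lborel h"
    and zero: "\<And>a. (\<integral>t. exp (\<i> * of_real (a * t)) * of_real (h t) \<partial>lborel) = 0"
  shows "AE t in lborel. h t = 0"
proof -
  note [measurable] = borel_measurable_integrable[OF h]
  define u v where "u t = max 0 (h t)" and "v t = max 0 (- h t)" for t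
  have uv: "integrable lborel u" "integrable lborel v" "\<And>t. 0 \<le> u t" "\<And>t. 0 \<le> v t" "\<And>t. h t = u t - v t"
    unfolding u_def v_def using h by (auto intro!: Bochner_Integration.integrable_max)
  note [measurable] = borel_measurable_integrable[OF uv(1)] borel_measurable_integrable[OF uv(2)]
  have int: "integrable lborel (\<lambda>t. exp (\<i> * of_real (a * t)) * complex_of_real (w t))"
    if "integrable lborel w" for w a
  proof (rule Bochner_Integration.integrable_bound[OF that])
    note [measurable] = borel_measurable_integrable[OF that]
    show "(\<lambda>t. exp (\<i> * of_real (a * t)) * complex_of_real (w t)) \<in> borel_measurable lborel"
      by measurable
  qed (simp add: norm_mult)
  have transform_eq: "(\<integral>t. exp (\<i> * of_real (a * t)) * complex_of_real (u t) \<partial>lborel)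
      = (\<integral>t. exp (\<i> * of_real (a * t)) * complex_of_real (v t) \<partial>lborel)" for a
    using zero[of a] int[OF uv(1)] int[OF uv(2)] by (simp add: uv(5) right_diff_distrib)
  define c where "c = (\<integral>t. u t \<partial>lborel)"
  \<comment> \<open>At frequency 0 the transforms are the total masses, so one constant normalises
    both parts.\<close>
  have "complex_of_real (\<integral>t. u t \<partial>lborel) = complex_of_real (\<integral>t. v t \<partial>lborel)"
    using transform_eq[of 0] by simp
  then have c_v: "c = (\<integral>t. v t \<partial>lborel)"
    by (simp add: c_def)
  show ?thesis
  proof (cases "c = 0")
    case True
    then have "AE t in lborel. u t = 0" "AE t in lborel. v t = 0"
      using integral_nonneg_eq_0_iff_AE[OF uv(1)] integral_nonneg_eq_0_iff_AE[OF uv(2)] uv(3,4)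
      by (simp_all add: c_def flip: c_v)
    then show ?thesis
      by eventually_elim (simp add: uv(5))
  next
    case False
    then have c: "0 < c"
      using uv(3) by (simp add: c_def order.strict_iff_order integral_nonneg_AE)
    define D where "D w = density lborel (\<lambda>t. ennreal (w t / c))" for w :: "real \<Rightarrow> real"
    have distr: "real_distribution (D w)"
      if "integrable lborel w" "\<And>t. 0 \<le> w t" "(\<integral>t. w t \<partial>lborel) = c" for w
    proof -
      note [measurable] = borel_measurable_integrable[OF that(1)]
      have "(\<integral>\<^sup>+t. ennreal (w t / c) \<partial>lborel) = ennreal (\<integral>t. w t / c \<partial>lborel)"
        using that c by (intro nn_integral_eq_integral) auto
      also have "\<dots> = 1"
        using that c by simp
      finally have "prob_space (D w)"
        unfolding D_def by (intro prob_spaceI) (simp add: emeasure_density)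
      then show ?thesis
        by (simp add: real_distribution_def real_distribution_axioms_def D_def)
    qed
    have char: "char (D w) a = (\<integral>t. exp (\<i> * of_real (a * t)) * of_real (w t) \<partial>lborel) / of_real c"
      if "integrable lborel w" "\<And>t. 0 \<le> w t" for w a
    proof -
      note [measurable] = borel_measurable_integrable[OF that(1)]
      have "char (D w) a = (\<integral>t. (w t / c) *\<^sub>R exp (\<i> * of_real (a * t)) \<partial>lborel)"
        unfolding char_def D_def using that c by (intro integral_density) auto
      also have "\<dots> = (\<integral>t. exp (\<i> * of_real (a * t)) * of_real (w t) / of_real c \<partial>lborel)"
        by (simp add: scaleR_conv_of_real mult.commute)
      finally show ?thesis
        by simp
    qed
    have "char (D u) = char (D v)"
      using uv transform_eq by (simp add: fun_eq_iff char)
    then have "D u = D v"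
      using uv by (intro Levy_uniqueness distr) (simp_all add: c_def flip: c_v)
    then have "AE t in lborel. ennreal (u t / c) = ennreal (v t / c)"
      unfolding D_def by (intro sigma_finite_measure.density_unique[OF lborel.sigma_finite_measure_axioms]) auto
    then show ?thesis
      by eventually_elim (use uv c in simp)
  qed
qed

text \<open>The transform of the conjugate of \<open>h\<close> at a is the conjugate of the
  transform of \<open>h\<close> at -a, hence zero too. The real and imaginary parts are linear
  combinations of \<open>h\<close> and its conjugate, so the real case applies to each.\<close>

lemma fourier_unique:
  fixes h :: "real \<Rightarrow> complex"
  assumes h: "integrable lborel h"
    and zero: "\<And>a. (\<integral>t. exp (\<i> * of_real (a * t)) * h t \<partial>lborel) = 0"
  shows "AE t in lborel. h t = 0"
proof -
  have "integrable lborel (\<lambda>t. cnj (h t))"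
    using h by simp
  note [measurable] = borel_measurable_integrable[OF h] borel_measurable_integrable[OF this]
  have int: "integrable lborel (\<lambda>t. exp (\<i> * of_real (a * t)) * h t)" for a
    by (rule Bochner_Integration.integrable_bound[OF h]) (auto simp: norm_mult)
  have int': "integrable lborel (\<lambda>t. exp (\<i> * of_real (a * t)) * cnj (h t))" for a
    by (rule Bochner_Integration.integrable_bound[OF h]) (auto simp: norm_mult)
  have zero': "(\<integral>t. exp (\<i> * of_real (a * t)) * cnj (h t) \<partial>lborel) = 0" for a
  proof -
    have "(\<integral>t. exp (\<i> * of_real (a * t)) * cnj (h t) \<partial>lborel)
        = (\<integral>t. cnj (exp (\<i> * of_real (- a * t)) * h t) \<partial>lborel)"
      by (simp add: exp_cnj)
    also have "\<dots> = cnj (\<integral>t. exp (\<i> * of_real (- a * t)) * h t \<partial>lborel)"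
      by (rule Bochner_Integration.integral_cnj)
    finally show ?thesis
      by (simp only: zero complex_cnj_zero)
  qed
  have "AE t in lborel. Re (h t) = 0"
  proof (rule fourier_unique_real)
    fix a
    have "exp (\<i> * of_real (a * t)) * complex_of_real (Re (h t))
        = (exp (\<i> * of_real (a * t)) * h t + exp (\<i> * of_real (a * t)) * cnj (h t)) / 2" for t
      by (simp add: complex_add_cnj flip: distrib_left)
    then show "(\<integral>t. exp (\<i> * of_real (a * t)) * complex_of_real (Re (h t)) \<partial>lborel) = 0"
      using int[of a] int'[of a] zero[of a] zero'[of a] by (simp only:) simp
  qed (use h in simp)
  moreover have "AE t in lborel. Im (h t) = 0"
  proof (rule fourier_unique_real)
    fix a
    have "exp (\<i> * of_real (a * t)) * complex_of_real (Im (h t))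
        = (exp (\<i> * of_real (a * t)) * h t - exp (\<i> * of_real (a * t)) * cnj (h t)) / (2 * \<i>)" for t
      unfolding right_diff_distrib[symmetric] complex_diff_cnj
      by (subst nonzero_eq_divide_eq) (simp_all add: ac_simps)
    then show "(\<integral>t. exp (\<i> * of_real (a * t)) * complex_of_real (Im (h t)) \<partial>lborel) = 0"
      using int[of a] int'[of a] zero[of a] zero'[of a] by (simp only:) simp
  qed (use h in simp)
  ultimately show ?thesis
    by eventually_elim (simp add: complex_eq_iff)
qed

lemma distr_deriv_Psi_eq_0:
  assumes p: "1 \<le> p" and f: "f \<in> Lp_fun p" and zero: "distr_deriv (Psi f) = (\<lambda>\<phi>. 0)"
  shows "AE t in lebesgue. f t = 0"
proof -
  obtain f' where f': "f' \<in> borel_measurable borel" "f' \<in> Lp_fun p" "AE t in lebesgue. f t = f' t"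
    using Lp_borel_representative[OF f] .
  note [measurable] = f'(1)
  have "Psi f = Psi f'"
    using f f' by (intro Psi_cong_AE) (auto dest: Lp_funD(1))
  \<comment> \<open>Up to a constant, the weight is the modulus of the transform of the Gaussian
    test functions. It makes the product integrable for every \<open>p\<close> and never vanishes,
    so \<open>h\<close> still determines \<open>f'\<close>.\<close>
  define h where "h t = f' t * of_real (exp (- t\<^sup>2 / 2))" for t
  have "integrable lborel h"
  proof (rule Bochner_Integration.integrable_bound)
    show "integrable lborel (\<lambda>t. 2 * (cmod (f' t) / (1 + \<bar>t\<bar>)))"
    proof (rule integrable_mult_right)
      show "integrable lborel (\<lambda>t. cmod (f' t) / (1 + \<bar>t\<bar>))"
        using Lp_integrable_decay[OF p f'(2)] by (subst (asm) integrable_completion) auto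
    qed
    show "h \<in> borel_measurable lborel"
      unfolding h_def by measurable
    \<comment> \<open>Compares the Gaussian with the weight against which L^p functions are
      integrable, using (|t| - 1)^2 \<ge> 0 and 1 + x \<le> e^x.\<close>
    have exp_le: "exp (- t\<^sup>2 / 2) \<le> 2 / (1 + \<bar>t\<bar>)" for t :: real
    proof -
      have "(1 + \<bar>t\<bar>) / 2 \<le> 1 + t\<^sup>2 / 2"
        using zero_le_power2[of "\<bar>t\<bar> - 1"] by (simp add: power2_diff)
      also have "\<dots> \<le> exp (t\<^sup>2 / 2)"
        by (rule exp_ge_add_one_self)
      finally show ?thesis
        by (simp add: exp_minus field_simps)
    qed
    show "AE t in lborel. norm (h t) \<le> norm (2 * (cmod (f' t) / (1 + \<bar>t\<bar>)))"
    proof (rule AE_I2)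
      fix t
      show "norm (h t) \<le> norm (2 * (cmod (f' t) / (1 + \<bar>t\<bar>)))"
        using mult_left_mono[OF exp_le[of t], of "cmod (f' t)"]
        by (simp add: h_def norm_mult mult.commute)
    qed
  qed
  moreover have "(\<integral>t. exp (\<i> * of_real (a * t)) * h t \<partial>lborel) = 0" for a
  proof -
    \<comment> \<open>The transform of a Gaussian centred at b carries e^(-ibt), so frequency
      \<open>a\<close> calls for the centre \<open>- a\<close>.\<close>
    have "0 = distr_deriv (Psi f') (gauss (- a))"
      using zero \<open>Psi f = Psi f'\<close> by simp
    also have "\<dots> = (\<integral>t. of_real (sqrt (2 * pi)) * (exp (\<i> * of_real (a * t)) * h t) \<partial>lborel)"
      unfolding distr_deriv_Psi[OF p f'(2,1) gauss_schwartz] fourier_gauss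
      by (intro Bochner_Integration.integral_cong refl) (simp add: h_def mult_ac)
    also have "\<dots> = of_real (sqrt (2 * pi)) * (\<integral>t. exp (\<i> * of_real (a * t)) * h t \<partial>lborel)"
      by (rule integral_mult_right_zero)
    finally show ?thesis
      by simp
  qed
  ultimately have "AE t in lborel. h t = 0"
    by (rule fourier_unique)
  then have "AE t in lebesgue. h t = 0"
    by (rule AE_completion)
  with f'(3) show ?thesis
    by eventually_elim (simp add: h_def)
qed

section \<open>Linearity and injectivity modulo null sets\<close>

lemma distr_deriv_Psi_add:
  assumes "1 \<le> p" "f \<in> Lp_fun p" "g \<in> Lp_fun p"
  shows "distr_deriv (Psi (\<lambda>t. f t + g t)) \<phi> = distr_deriv (Psi f) \<phi> + distr_deriv (Psi g) \<phi>"
proof (cases "\<phi> \<in> schwartz")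
  case True
  have sum: "(\<lambda>t. f t + g t) \<in> Lp_fun p"
    using assms by (intro Lp_fun_add) auto
  have int: "integrable lborel (\<lambda>s. Psi h s * vderiv \<phi> s)" if h: "h \<in> Lp_fun p" for h
    using Psi_bound[OF assms(1) h] integrable_growth_vderiv[OF Psi_borel_measurable[OF h] _ _ True]
    by blast
  show ?thesis
    using assms int[OF assms(2)] int[OF assms(3)]
    by (simp add: distr_deriv_lborel[OF Psi_borel_measurable[OF sum] True]
        distr_deriv_lborel[OF Psi_borel_measurable[OF assms(2)] True]
        distr_deriv_lborel[OF Psi_borel_measurable[OF assms(3)] True] Psi_add distrib_right)
qed (simp add: distr_deriv_def)

lemma distr_deriv_Psi_cmult: "distr_deriv (Psi (\<lambda>t. c * f t)) \<phi> = c * distr_deriv (Psi f) \<phi>"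
  by (simp add: distr_deriv_def Psi_cmult mult.assoc)

lemma distr_deriv_Psi_eq_iff:
  assumes p: "1 \<le> p" and fg: "f \<in> Lp_fun p" "g \<in> Lp_fun p"
  shows "distr_deriv (Psi f) = distr_deriv (Psi g) \<longleftrightarrow> (AE t in lebesgue. f t = g t)"
proof
  assume eq: "distr_deriv (Psi f) = distr_deriv (Psi g)"
  \<comment> \<open>The difference is written with a factor -1 so that additivity and homogeneity
    reduce injectivity to the kernel.\<close>
  have "distr_deriv (Psi (\<lambda>t. f t + - 1 * g t)) = (\<lambda>\<phi>. 0)"
    using fg eq by (simp only: distr_deriv_Psi_add[OF p _ Lp_fun_cmult] distr_deriv_Psi_cmult fun_eq_iff) simp
  then have "AE t in lebesgue. f t + - 1 * g t = 0"
    by (rule distr_deriv_Psi_eq_0[OF p, rotated]) (use p fg Lp_fun_diff[OF _ fg] in simp)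
  then show "AE t in lebesgue. f t = g t"
    by simp
next
  assume "AE t in lebesgue. f t = g t"
  then show "distr_deriv (Psi f) = distr_deriv (Psi g)"
    using Psi_cong_AE[OF Lp_funD(1)[OF fg(1)] Lp_funD(1)[OF fg(2)]] by simp
qed

text \<open>Equal functions have equal distributional derivatives, so injectivity is inherited from
  the derivative.\<close>

lemma Psi_eq_iff:
  assumes p: "1 \<le> p" and fg: "f \<in> Lp_fun p" "g \<in> Lp_fun p"
  shows "Psi f = Psi g \<longleftrightarrow> (AE t in lebesgue. f t = g t)"
  using distr_deriv_Psi_eq_iff[OF assms] Psi_cong_AE[OF Lp_funD(1)[OF fg(1)] Lp_funD(1)[OF fg(2)]]
  by auto

lemma Lp_realization_B_space:
  assumes p: "1 \<le> p"
  shows "Lp_realization p (B_space p) Psi"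
  by (rule Lp_realization_function_space[OF p])
     (simp_all add: B_space_def Psi_eq_iff[OF p] Psi_add[OF p] Psi_cmult)

lemma Lp_realization_A_space:
  assumes p: "1 \<le> p"
  shows "Lp_realization p (A_space p) (\<lambda>f. distr_deriv (Psi f))"
  by (rule Lp_realization_function_space[OF p])
     (simp_all add: A_space_def distr_deriv_Psi_eq_iff[OF p] distr_deriv_Psi_add[OF p] distr_deriv_Psi_cmult)

theorem theorem3p1:
  fixes p :: real
  assumes "1 \<le> p"
  shows
    "((\<forall>f \<in> Lp_fun p. \<forall>g \<in> Lp_fun p. Psi f = Psi g \<longrightarrow> Lp_norm p f = Lp_norm p g) \<and>
      (\<forall>f \<in> Lp_fun p. nrm (B_space p) (Psi f) = Lp_norm p f) \<and>
      complex_normed_space (B_space p) \<and>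
      complex_banach_space (B_space p) \<and>
      isometrically_isomorphic (B_space p) (Lp_space p))
     \<and>
     (carrier (A_space p) \<subseteq> tempered_distributions \<and>
      (\<forall>f \<in> Lp_fun p. \<forall>g \<in> Lp_fun p.
         distr_deriv (Psi f) = distr_deriv (Psi g) \<longrightarrow> Lp_norm p f = Lp_norm p g) \<and>
      (\<forall>f \<in> Lp_fun p. nrm (A_space p) (distr_deriv (Psi f)) = Lp_norm p f) \<and>
      complex_normed_space (A_space p) \<and>
      complex_banach_space (A_space p) \<and>
      isometrically_isomorphic (A_space p) (Lp_space p))
     \<and>
     (complex_banach_space (Lp_space p) \<and>
      isometrically_isomorphic (Lp_space p) (B_space p) \<and>
      isometrically_isomorphic (B_space p) (A_space p) \<and>
      isometrically_isomorphic (Lp_space p) (A_space p))"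
proof -
  note L = Lp_realization_Lp_space[OF assms] and B = Lp_realization_B_space[OF assms]
    and A = Lp_realization_A_space[OF assms]
  have norm_eq: "Lp_norm p f = Lp_norm p g"
    if "f \<in> Lp_fun p" "g \<in> Lp_fun p" "AE t in lebesgue. f t = g t" for f g
    using Lp_norm_cong_AE[OF Lp_funD(1)[OF that(1)] Lp_funD(1)[OF that(2)] that(3)] .
  have norm_eq_B: "\<forall>f\<in>Lp_fun p. \<forall>g\<in>Lp_fun p. Psi f = Psi g \<longrightarrow> Lp_norm p f = Lp_norm p g"
    by (intro ballI impI norm_eq) (simp_all add: Psi_eq_iff[OF assms])
  have norm_eq_A: "\<forall>f\<in>Lp_fun p. \<forall>g\<in>Lp_fun p.
      distr_deriv (Psi f) = distr_deriv (Psi g) \<longrightarrow> Lp_norm p f = Lp_norm p g"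
    by (intro ballI impI norm_eq) (simp_all add: distr_deriv_Psi_eq_iff[OF assms])
  have tempered: "carrier (A_space p) \<subseteq> tempered_distributions"
  proof -
    have "distr_deriv (Psi f) \<in> tempered_distributions" if f: "f \<in> Lp_fun p" for f
      using Psi_bound[OF assms f] distr_deriv_tempered[OF Psi_borel_measurable[OF f]] by blast
    then show ?thesis
      by (auto simp: A_space_def)
  qed
  show ?thesis
    by (intro conjI ballI norm_eq_B norm_eq_A tempered
        Lp_realization.nrm_Phi[OF B] Lp_realization.nrm_Phi[OF A]
        Lp_realization.complex_normed_space[OF B] Lp_realization.complex_normed_space[OF A]
        Lp_realization.complex_banach_space[OF L] Lp_realization.complex_banach_space[OF B]
        Lp_realization.complex_banach_space[OF A]
        Lp_realizations_isometric[OF B L] Lp_realizations_isometric[OF A L]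
        Lp_realizations_isometric[OF L B] Lp_realizations_isometric[OF B A]
        Lp_realizations_isometric[OF L A])
qed

end
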